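(* Let $\lambda>0$ and let $U$ be an exponentially distributed random variable with parameter $\lambda$. Let $\Gamma^+(t)$, $t>0$, be the sojourn time on the positive half-line up to time $t$ of a standard Brownian motion independent of $U$, so that $\Gamma^+(t)$ has density $q^+(s,t)=\frac{1}{\pi\sqrt{s(t-s)}}$, $0<s<t$. Then the crossing probability of $U$ by $\Gamma^+(t)$ is given by $$\psi^+(t)=\Pr\{\Gamma^+(t)<U\}=e^{-\lambda t/2}I_0\left(\frac{\lambda t}{2}\right),\qquad t>0,$$ and it solves the second-order differential equation $$\frac{d^2\psi^+}{dt^2}+\left(\lambda+\frac1t\right)\frac{d\psi^+}{dt}=-\frac{\lambda}{2t}\psi^+,\quad t>0,\qquad \psi^+(0)=1.$$
   Context: $\Gamma^+(t)=\mathrm{meas}\{s<t: B(s)>0\}$ (Lebesgue measure), where $B$ is a Brownian motion on $\mathbb{R}$ started at $0$. $I_0(w)=\sum_{k=0}^\infty\frac{(w/2)^{2k}}{(k!)^2}$ is the modified Bessel function of order zero. "Exponential with parameter $\lambda$" means density $\lambda e^{-\lambda y}$, $y>0$. *)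

theory Defs
  imports "HOL-Probability.Probability"
begin

text \<open>
  Standard Brownian motion on the real line, started at 0. Only the times \<open>t \<ge> 0\<close> are
  constrained. All paths (not just almost all) are required to be continuous: the underlying
  probability space need not be complete, and with merely almost surely continuous paths the
  sojourn time below could fail to be measurable.
\<close>

locale brownian_motion = prob_space M for M :: "'a measure" +
  fixes B :: "real \<Rightarrow> 'a \<Rightarrow> real"
  assumes random_variable_B: "t \<ge> 0 \<Longrightarrow> random_variable borel (B t)"
    and B_start: "AE \<omega> in M. B 0 \<omega> = 0"
    and B_continuous: "\<omega> \<in> space M \<Longrightarrow> continuous_on {0..} (\<lambda>t. B t \<omega>)"
    and B_gaussian_increments:
      "0 \<le> s \<Longrightarrow> s < t \<Longrightarrow>
        distributed M lborel (\<lambda>\<omega>. B t \<omega> - B s \<omega>) (normal_density 0 (sqrt (t - s)))"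
    and B_independent_increments:
      "0 \<le> \<tau> 0 \<Longrightarrow> (\<And>i. i < n \<Longrightarrow> \<tau> i < \<tau> (Suc i)) \<Longrightarrow>
        indep_vars (\<lambda>_. borel) (\<lambda>i \<omega>. B (\<tau> (Suc i)) \<omega> - B (\<tau> i) \<omega>) {..<(n::nat)}"

definition sojourn_pos :: "(real \<Rightarrow> 'a \<Rightarrow> real) \<Rightarrow> real \<Rightarrow> 'a \<Rightarrow> real" where
  "sojourn_pos B t \<omega> = measure lborel {s. 0 \<le> s \<and> s < t \<and> B s \<omega> > 0}"

definition sojourn_density :: "real \<Rightarrow> real \<Rightarrow> real" where
  "sojourn_density t s = (if 0 < s \<and> s < t then 1 / (pi * sqrt (s * (t - s))) else 0)"

definition crossing_prob ::
  "'a measure \<Rightarrow> (real \<Rightarrow> 'a \<Rightarrow> real) \<Rightarrow> ('a \<Rightarrow> real) \<Rightarrow> real \<Rightarrow> real" where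
  "crossing_prob M B U t = \<P>(\<omega> in M. sojourn_pos B t \<omega> < U \<omega>)"

definition bessel_I0 :: "real \<Rightarrow> real" where
  "bessel_I0 w = (\<Sum>k. (w / 2) ^ (2 * k) / (fact k)\<^sup>2)"

end

theory Submission imports Defs begin

text \<open>
  The arcsine law is obtained from random walks. Sampled on a grid of mesh \<open>t / n\<close>, Brownian motion
  is a walk with independent, symmetric, atomless steps. By Sparre Andersen's theorem its number of
  positive partial sums among the first \<open>n\<close> is distributed like the index of the first maximum, and
  the latter splits the walk into two independent pieces; this gives
  \<open>P(N = k) = a k * a (n - k)\<close>, and summing over \<open>k\<close> forces \<open>a k = (1/2)(3/2)\<dots>(k - 1/2) / k!\<close>.
  The binomial moments of \<open>N\<close> are then explicit. Since \<open>t N / n\<close> converges almost surely to the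
  sojourn time, the moments of the latter are \<open>t ^ j * a j\<close>, which are those of the arcsine density
  (a Beta integral), and a bounded distribution is determined by its moments.

  By independence the crossing probability is the Laplace transform \<open>E exp (- lam \<Gamma>)\<close>, that is
  \<open>F (lam t)\<close> with \<open>F x = \<Sum>k. (-1)^k a k x^k / k!\<close>, Kummer's function \<open>1F1(1/2; 1; - x)\<close>.
  The coefficient recurrence of \<open>F\<close> is the differential equation, and that of \<open>exp (x / 2) * F x\<close>
  identifies the Bessel function.
\<close>

subsection \<open>The arcsine coefficients\<close>

text \<open>These are the numbers \<open>(2 k choose k) / 4 ^ k\<close>, the Taylor coefficients of
  \<open>(1 - x) powr (-1/2)\<close>; they are also the moments of the arcsine law on the unit
  interval.\<close>

definition arc_coeff :: "nat \<Rightarrow> real" where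
  "arc_coeff k = pochhammer (1/2) k / fact k"

text \<open>Splitting off \<open>pochhammer (1/2) j\<close> leaves Vandermonde's identity for rising
  factorials with parameters \<open>1/2 + j\<close> and \<open>1/2\<close>, which add up to
  \<open>1 + j\<close>. For \<open>j = 0\<close> the left side is the convolution square, equal to
  1; for general \<open>j\<close> it is a binomial moment of the law found later for
  \<open>npos\<close>.\<close>

lemma arc_coeff_convolution:
  assumes "j \<le> n"
  shows "(\<Sum>k\<le>n. real (k choose j) * (arc_coeff k * arc_coeff (n - k)))
    = arc_coeff j * real (n choose j)"
proof -
  define m where "m = n - j"
  have n: "n = m + j" using assms m_def by simp
  have poch_shift: "pochhammer (1/2::real) (i + j)
      = pochhammer (1/2) j * pochhammer (1/2 + real j) i" for i
    using pochhammer_product'[of "1/2::real" j i] by (simp add: add.commute)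
  have "(\<Sum>k\<le>n. real (k choose j) * (arc_coeff k * arc_coeff (n - k)))
      = (\<Sum>k\<in>{j..n}. real (k choose j) * (arc_coeff k * arc_coeff (n - k)))"
    by (rule sum.mono_neutral_right) (auto simp: binomial_eq_0)
  also have "\<dots> = (\<Sum>i\<le>m. real (i + j choose j) * (arc_coeff (i + j) * arc_coeff (m - i)))"
    by (rule sum.reindex_bij_witness[of _ "\<lambda>i. i + j" "\<lambda>k. k - j"]) (auto simp: n)
  also have "\<dots> = (\<Sum>i\<le>m. arc_coeff j / fact m *
      (real (m choose i) * pochhammer (1/2 + real j) i * pochhammer (1/2) (m - i)))"
  proof (rule sum.cong)
    fix i assume i: "i \<in> {..m}"
    have "real (i + j choose j) = fact (i + j) / (fact j * fact i)"
      by (subst binomial_fact) auto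
    moreover have "real (m choose i) = fact m / (fact i * fact (m - i))"
      using i by (subst binomial_fact) auto
    ultimately show "real (i + j choose j) * (arc_coeff (i + j) * arc_coeff (m - i))
      = arc_coeff j / fact m *
        (real (m choose i) * pochhammer (1/2 + real j) i * pochhammer (1/2) (m - i))"
      by (simp add: arc_coeff_def poch_shift)
  qed simp
  also have "\<dots> = arc_coeff j / fact m * pochhammer (1 + real j) m"
    unfolding sum_distrib_left[symmetric] pochhammer_binomial_sum[symmetric] by (simp add: add.commute)
  also have "pochhammer (1 + real j) m = fact (m + j) / fact j"
    using pochhammer_product'[of "1::real" j m]
    by (simp add: pochhammer_fact[symmetric] add.commute field_simps)
  also have "arc_coeff j / fact m * (fact (m + j) / fact j) = arc_coeff j * real (n choose j)"
    using assms by (subst binomial_fact) (auto simp: n field_simps)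
  finally show ?thesis .
qed

text \<open>For positive \<open>n\<close> the convolution contains \<open>p n\<close> only in the
  terms \<open>k = 0\<close> and \<open>k = n\<close>; all other factors have smaller positive index
  and are known by induction. Nonnegativity selects the root \<open>p 0 = 1\<close> of
  \<open>p 0 * p 0 = 1\<close>.\<close>

lemma arc_coeff_unique:
  fixes p :: "nat \<Rightarrow> real"
  assumes nonneg: "\<And>n. 0 \<le> p n" and conv: "\<And>n. (\<Sum>k\<le>n. p k * p (n - k)) = 1"
  shows "p n = arc_coeff n"
proof (induction n rule: less_induct)
  case (less n)
  have a: "(\<Sum>k\<le>n. arc_coeff k * arc_coeff (n - k)) = 1" for n
    using arc_coeff_convolution[of 0 n] by (simp add: arc_coeff_def)
  have "p 0 * p 0 = 1" using conv[of 0] by simp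
  then have p0: "p 0 = 1" using nonneg[of 0] by (simp add: square_eq_1_iff)
  have a0: "arc_coeff 0 = 1" by (simp add: arc_coeff_def)
  show ?case
  proof (cases n)
    case 0 then show ?thesis using p0 a0 by simp
  next
    case (Suc m)
    have split: "(\<Sum>k\<le>n. f k * f (n - k))
        = 2 * f n + (\<Sum>k\<in>{1..m}. f k * f (n - k))" if "f 0 = 1" for f :: "nat \<Rightarrow> real"
    proof -
      have "{..n} = insert 0 (insert n {1..m})" using Suc by auto
      then show ?thesis using Suc that by simp
    qed
    have "(\<Sum>k\<in>{1..m}. p k * p (n - k)) = (\<Sum>k\<in>{1..m}. arc_coeff k * arc_coeff (n - k))"
      using less Suc by (intro sum.cong) auto
    then show ?thesis using split[of p] split[of arc_coeff] p0 a0 conv[of n] a[of n] by simp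
  qed
qed

subsection \<open>Random walks and Sparre Andersen's theorem\<close>

definition psum :: "(nat \<Rightarrow> real) \<Rightarrow> nat \<Rightarrow> real" where
  "psum x n = (\<Sum>i<n. x i)"

definition npos :: "(nat \<Rightarrow> real) \<Rightarrow> nat \<Rightarrow> nat" where
  "npos x n = (\<Sum>k<n. if 0 < psum x (Suc k) then 1 else 0)"

text \<open>The index of the first maximum among the partial sums \<open>0, \<dots>, n\<close>. In this recursive form the
  first maximum obeys the same recursion in law as \<open>npos\<close>: if the total is positive, the maximum is
  not at \<open>0\<close> and the first step can be dropped.\<close>

fun first_max :: "(nat \<Rightarrow> real) \<Rightarrow> nat \<Rightarrow> nat" where
  "first_max x 0 = 0"
| "first_max x (Suc n) =
    (if psum x (Suc n) \<le> 0 then first_max x n else Suc (first_max (\<lambda>i. x (Suc i)) n))"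

lemma psum_0 [simp]: "psum x 0 = 0"
  by (simp add: psum_def)

lemma psum_Suc: "psum x (Suc n) = psum x n + x n"
  by (simp add: psum_def)

lemma psum_Suc_shift: "psum x (Suc n) = x 0 + psum (\<lambda>i. x (Suc i)) n"
  unfolding psum_def by (rule sum.lessThan_Suc_shift)

lemma psum_add: "psum x (m + n) = psum x m + psum (\<lambda>i. x (m + i)) n"
  by (induction n) (simp_all add: psum_Suc)

lemma psum_cong: "(\<And>i. i < n \<Longrightarrow> x i = y i) \<Longrightarrow> psum x n = psum y n"
  by (simp add: psum_def)

lemma npos_cong: "(\<And>i. i < n \<Longrightarrow> x i = y i) \<Longrightarrow> npos x n = npos y n"
  unfolding npos_def by (intro sum.cong refl if_cong arg_cong2[where f="(<)"] psum_cong) auto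

lemma npos_le: "npos x n \<le> n"
  using sum_bounded_above[of "{..<n}" "\<lambda>k. if 0 < psum x (Suc k) then 1 else 0" "1::nat"]
  by (simp add: npos_def)

lemma npos_Suc: "npos x (Suc n) = (if 0 < psum x (Suc n) then Suc (npos x n) else npos x n)"
  by (simp add: npos_def)

lemma npos_eq_0_iff: "npos x n = 0 \<longleftrightarrow> (\<forall>k<n. psum x (Suc k) \<le> 0)"
  by (auto simp: npos_def not_less split: if_splits)

lemma npos_eq_n_iff: "npos x n = n \<longleftrightarrow> (\<forall>k<n. 0 < psum x (Suc k))"
proof (induction n)
  case (Suc n)
  then show ?case using npos_le[of x n] by (auto simp: npos_Suc less_Suc_eq)
qed (simp add: npos_def)

lemma first_max_cong: "(\<And>i. i < n \<Longrightarrow> x i = y i) \<Longrightarrow> first_max x n = first_max y n"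
proof (induction n arbitrary: x y)
  case (Suc n)
  have "psum x (Suc n) = psum y (Suc n)" by (rule psum_cong) (rule Suc.prems)
  moreover have "first_max x n = first_max y n" by (rule Suc.IH) (simp add: Suc.prems)
  moreover have "first_max (\<lambda>i. x (Suc i)) n = first_max (\<lambda>i. y (Suc i)) n"
    by (rule Suc.IH) (simp add: Suc.prems)
  ultimately show ?case by simp
qed simp

text \<open>If the total is nonpositive, the last point cannot exceed the maximum, since
  \<open>psum x 0 = 0\<close> already competes. If it is positive, index 0 is not a maximum, and
  dropping the first step lowers all remaining partial sums by the same \<open>x 0\<close>, which
  leaves their comparisons intact.\<close>

lemma first_max_properties:
  "first_max x n \<le> n \<and> (\<forall>j<first_max x n. psum x j < psum x (first_max x n))
    \<and> (\<forall>j\<le>n. psum x j \<le> psum x (first_max x n))"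
proof (induction n arbitrary: x)
  case (Suc n)
  show ?case
  proof (cases "psum x (Suc n) \<le> 0")
    case True
    have "psum x 0 \<le> psum x (first_max x n)" using Suc.IH[of x] by blast
    with True Suc.IH[of x] show ?thesis by (auto simp: le_Suc_eq)
  next
    case False
    define k where "k = first_max (\<lambda>i. x (Suc i)) n"
    have IH: "k \<le> n" "\<And>j. j < k \<Longrightarrow> psum x (Suc j) < psum x (Suc k)"
      "\<And>j. j \<le> n \<Longrightarrow> psum x (Suc j) \<le> psum x (Suc k)"
      using Suc.IH[of "\<lambda>i. x (Suc i)"] by (auto simp: k_def psum_Suc_shift)
    have "0 < psum x (Suc k)" using IH(3)[of n] False by simp
    then have "psum x j < psum x (Suc k)" if "j < Suc k" for j
      using that IH(2) by (cases j) auto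
    moreover have "psum x j \<le> psum x (Suc k)" if "j \<le> Suc n" for j
      using that IH(3) \<open>0 < psum x (Suc k)\<close> by (cases j) auto
    ultimately have "(\<forall>j<Suc k. psum x j < psum x (Suc k)) \<and> (\<forall>j\<le>Suc n. psum x j \<le> psum x (Suc k))"
      by blast
    then show ?thesis using False IH(1) by (simp flip: k_def)
  qed
qed simp

text \<open>Strict inequalities before \<open>k\<close> and weak ones everywhere make
  \<open>k\<close> unique: of two candidates, the later would have to lie strictly above the earlier
  and also not above it.\<close>

lemma first_max_eq_iff:
  "first_max x n = k \<longleftrightarrow>
    k \<le> n \<and> (\<forall>j<k. psum x j < psum x k) \<and> (\<forall>j\<le>n. psum x j \<le> psum x k)"
proof
  assume "k \<le> n \<and> (\<forall>j<k. psum x j < psum x k) \<and> (\<forall>j\<le>n. psum x j \<le> psum x k)"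
  then show "first_max x n = k"
    using first_max_properties[of x n] by (cases "first_max x n" k rule: linorder_cases) force+
qed (use first_max_properties in blast)

text \<open>The first \<open>k\<close> steps must make \<open>k\<close> a strict record, and the
  later steps must never rise above the level reached at \<open>k\<close>. These two conditions
  concern disjoint blocks of steps, which is the source of the independence used below.\<close>

lemma first_max_split:
  assumes "k \<le> n"
  shows "first_max x n = k \<longleftrightarrow>
    first_max x k = k \<and> first_max (\<lambda>i. x (k + i)) (n - k) = 0"
proof -
  have "(\<forall>j\<le>n. psum x j \<le> psum x k) \<longleftrightarrow>
      (\<forall>j<k. psum x j \<le> psum x k) \<and> (\<forall>j\<le>n - k. psum x (k + j) \<le> psum x k)"
  proof (intro iffI conjI allI impI)
    fix j assume "\<forall>j\<le>n. psum x j \<le> psum x k" "j \<le> n - k"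
    then show "psum x (k + j) \<le> psum x k" using assms by simp
  next
    fix j assume *: "(\<forall>j<k. psum x j \<le> psum x k) \<and> (\<forall>j\<le>n - k. psum x (k + j) \<le> psum x k)" "j \<le> n"
    then have "psum x (k + (j - k)) \<le> psum x k" by (intro conjunct2[OF *(1), rule_format]) auto
    with * show "psum x j \<le> psum x k" by (cases "j < k") auto
  qed (use assms in auto)
  then show ?thesis
    using assms by (auto simp: first_max_eq_iff psum_add order.strict_implies_order le_less)
qed

section \<open>Walks whose steps are the coordinates of a product space with symmetric, atomless
  factors\<close>

locale symmetric_walk = sequence_space M for M :: "real measure" +
  assumes sets_M [measurable_cong, simp]: "sets M = sets borel"
    and symmetric: "distr M borel uminus = M"
    and atomless: "emeasure M {x} = 0"
begin

lemma space_M [simp]: "space M = UNIV"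
  using sets_eq_imp_space_eq[OF sets_M] by simp

lemma measurable_M [simp]: "measurable M N = measurable borel N"
  by (rule measurable_cong_sets) simp_all

lemma space_S [simp]: "space S = UNIV"
  by (simp add: space_PiM PiE_def extensional_def)

lemma measurable_component [measurable]: "(\<lambda>\<omega>. \<omega> i) \<in> borel_measurable S"
  using measurable_component_singleton[of i UNIV "\<lambda>_. M"] by simp

lemma measurable_psum [measurable]: "(\<lambda>\<omega>. psum \<omega> n) \<in> borel_measurable S"
  unfolding psum_def by measurable

lemma measurable_npos [measurable]: "(\<lambda>\<omega>. npos \<omega> n) \<in> S \<rightarrow>\<^sub>M count_space UNIV"
  unfolding npos_def by measurable

lemma measurable_shift: "(\<lambda>\<omega> i. \<omega> (k + i)) \<in> S \<rightarrow>\<^sub>M S"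
  by (rule measurable_PiM_single') auto

lemma measurable_first_max [measurable]: "(\<lambda>\<omega>. first_max \<omega> n) \<in> S \<rightarrow>\<^sub>M count_space UNIV"
proof (induction n)
  case (Suc n)
  have "(\<lambda>\<omega>. first_max (\<lambda>i. \<omega> (Suc i)) n) \<in> S \<rightarrow>\<^sub>M count_space UNIV"
    using measurable_compose[OF measurable_shift[of 1] Suc] by simp
  with Suc show ?case unfolding first_max.simps by measurable
qed simp

text \<open>Splicing the first \<open>k\<close> coordinates of one sequence onto an independent
  second sequence preserves the product measure. This is the independence of the first
  \<open>k\<close> steps from the later ones; the first form integrates the prefix last, the second
  form the suffix.\<close>

lemma nn_integral_comb_seq:
  assumes [measurable]: "F \<in> borel_measurable S"
  shows "(\<integral>\<^sup>+\<omega>. F \<omega> \<partial>S) = (\<integral>\<^sup>+\<omega>. (\<integral>\<^sup>+\<omega>'. F (comb_seq k \<omega> \<omega>') \<partial>S) \<partial>S)" (is ?left)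
    and "(\<integral>\<^sup>+\<omega>. F \<omega> \<partial>S) = (\<integral>\<^sup>+\<omega>'. (\<integral>\<^sup>+\<omega>. F (comb_seq k \<omega> \<omega>') \<partial>S) \<partial>S)" (is ?right)
proof -
  interpret SS: pair_sigma_finite S S ..
  have [measurable]: "(\<lambda>p. F (comb_seq k (fst p) (snd p))) \<in> borel_measurable (S \<Otimes>\<^sub>M S)"
    using measurable_compose[OF measurable_comb_seq assms] by (simp add: case_prod_beta)
  have "(\<integral>\<^sup>+\<omega>. F \<omega> \<partial>S) = (\<integral>\<^sup>+\<omega>. F \<omega> \<partial>distr (S \<Otimes>\<^sub>M S) S (\<lambda>(\<omega>, \<omega>'). comb_seq k \<omega> \<omega>'))"
    by (simp add: PiM_comb_seq)
  also have "\<dots> = (\<integral>\<^sup>+p. F (comb_seq k (fst p) (snd p)) \<partial>(S \<Otimes>\<^sub>M S))"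
    by (subst nn_integral_distr) (auto simp: case_prod_beta intro!: measurable_comb_seq)
  finally have *: "(\<integral>\<^sup>+\<omega>. F \<omega> \<partial>S) = (\<integral>\<^sup>+p. F (comb_seq k (fst p) (snd p)) \<partial>(S \<Otimes>\<^sub>M S))" .
  show ?left unfolding * by (subst P.nn_integral_fst[symmetric]) auto
  show ?right unfolding * by (subst SS.nn_integral_snd[symmetric]) (auto simp: case_prod_beta)
qed

lemma comb_seq_prefix: "i < k \<Longrightarrow> comb_seq k \<omega> \<omega>' i = \<omega> i"
  and comb_seq_suffix: "comb_seq k \<omega> \<omega>' (k + i) = \<omega>' i"
  by (simp_all add: comb_seq_def)

text \<open>Since \<open>g\<close> sees only the first \<open>n\<close> steps, the last step can be
  taken from an independent copy. With that step fixed, the inner integral concerns a walk of length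
  \<open>n\<close>, as an induction on the length requires.\<close>

lemma nn_integral_last_step:
  assumes [measurable]: "\<And>k. f k \<in> borel_measurable borel"
    and [measurable]: "(\<lambda>\<omega>. g \<omega>) \<in> S \<rightarrow>\<^sub>M count_space UNIV"
    and g: "\<And>x y. (\<And>i. i < n \<Longrightarrow> x i = y i) \<Longrightarrow> g x = (g y :: nat)"
  shows "(\<integral>\<^sup>+\<omega>. f (g \<omega>) (psum \<omega> (Suc n)) \<partial>S)
    = (\<integral>\<^sup>+\<omega>'. (\<integral>\<^sup>+\<omega>. f (g \<omega>) (psum \<omega> n + \<omega>' 0) \<partial>S) \<partial>S)"
proof -
  have "g (comb_seq n \<omega> \<omega>') = g \<omega>" for \<omega> \<omega>'
    by (rule g) (simp add: comb_seq_prefix)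
  moreover have "psum (comb_seq n \<omega> \<omega>') (Suc n) = psum \<omega> n + \<omega>' 0" for \<omega> \<omega>'
    using comb_seq_suffix[of n \<omega> \<omega>' 0] psum_cong[of n "comb_seq n \<omega> \<omega>'" \<omega>]
    by (simp add: psum_Suc comb_seq_prefix)
  ultimately show ?thesis
    by (subst nn_integral_comb_seq(2)[where k=n]) (auto intro!: measurable_compose_countable[where f="\<lambda>k \<omega>. f k (psum \<omega> (Suc n))" and g=g])
qed

text \<open>The induction needs the joint law with the endpoint, because both recursions branch on its sign:
  \<open>npos\<close> drops the last step and \<open>first_max\<close> the last or the first one, which are equal in law.\<close>

theorem sparre_andersen:
  assumes [measurable]: "\<And>k. f k \<in> borel_measurable borel"
  shows "(\<integral>\<^sup>+\<omega>. f (npos \<omega> n) (psum \<omega> n) \<partial>S) = (\<integral>\<^sup>+\<omega>. f (first_max \<omega> n) (psum \<omega> n) \<partial>S)"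
  using assms
proof (induction n arbitrary: f)
  case 0
  then show ?case by (simp add: npos_def)
next
  case (Suc n)
  note [measurable] = Suc.prems
  \<comment> \<open>The test function is cut at the sign of the endpoint: \<open>f1\<close> collects
    the case in which both counters keep a value from a walk of length \<open>n\<close>,
    \<open>f2\<close> the case in which both increase by one.\<close>
  define f1 :: "nat \<Rightarrow> real \<Rightarrow> ennreal" where "f1 k s = (if s \<le> 0 then f k s else 0)" for k s
  define f2 :: "nat \<Rightarrow> real \<Rightarrow> ennreal" where "f2 k s = (if s \<le> 0 then 0 else f (Suc k) s)" for k s
  have [measurable]: "f1 k \<in> borel_measurable borel" "f2 k \<in> borel_measurable borel" for k
    unfolding f1_def f2_def by measurable
  have mc: "(\<lambda>\<omega>. h (g \<omega>) (psum \<omega> m)) \<in> borel_measurable S"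
    if [measurable]: "\<And>k. h k \<in> borel_measurable borel" "g \<in> S \<rightarrow>\<^sub>M count_space UNIV"
    for h :: "nat \<Rightarrow> real \<Rightarrow> ennreal" and g m
    by (rule measurable_compose_countable[of "\<lambda>k \<omega>. h k (psum \<omega> m)"]) measurable
  have [measurable]: "(\<lambda>\<omega>. first_max (\<lambda>i. \<omega> (Suc i)) n) \<in> S \<rightarrow>\<^sub>M count_space UNIV"
    using measurable_compose[OF measurable_shift[of 1] measurable_first_max] by simp
  \<comment> \<open>The removed step acts as a constant \<open>c\<close> and is absorbed by
    translating the test function; hence the induction over arbitrary \<open>f\<close>.\<close>
  have IH: "(\<integral>\<^sup>+\<omega>. h (npos \<omega> n) (psum \<omega> n + c) \<partial>S) = (\<integral>\<^sup>+\<omega>. h (first_max \<omega> n) (psum \<omega> n + c) \<partial>S)"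
    if [measurable]: "\<And>k. h k \<in> borel_measurable borel" for h c
    by (rule Suc.IH[of "\<lambda>k s. h k (s + c)"]) measurable
  \<comment> \<open>Here the first step is removed instead of the last. What remains is again a full
    walk, independent of the removed step, so the double integral is the one that
    \<open>nn_integral_last_step\<close> produces.\<close>
  have shift: "(\<integral>\<^sup>+\<omega>. f2 (first_max (\<lambda>i. \<omega> (Suc i)) n) (psum \<omega> (Suc n)) \<partial>S)
      = (\<integral>\<^sup>+\<omega>'. (\<integral>\<^sup>+\<omega>. f2 (first_max \<omega> n) (psum \<omega> n + \<omega>' 0) \<partial>S) \<partial>S)"
  proof (subst nn_integral_comb_seq(1)[where k=1])
    have suffix: "(\<lambda>i. comb_seq 1 \<omega> \<omega>' (Suc i)) = \<omega>'" for \<omega> \<omega>' :: "nat \<Rightarrow> real"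
      using comb_seq_suffix[of 1 \<omega> \<omega>'] by auto
    have head: "comb_seq 1 \<omega> \<omega>' 0 = \<omega> 0" for \<omega> \<omega>' :: "nat \<Rightarrow> real"
      by (simp add: comb_seq_prefix)
    show "(\<integral>\<^sup>+\<omega>. \<integral>\<^sup>+\<omega>'. f2 (first_max (\<lambda>i. comb_seq 1 \<omega> \<omega>' (Suc i)) n) (psum (comb_seq 1 \<omega> \<omega>') (Suc n)) \<partial>S \<partial>S)
      = (\<integral>\<^sup>+\<omega>'. (\<integral>\<^sup>+\<omega>. f2 (first_max \<omega> n) (psum \<omega> n + \<omega>' 0) \<partial>S) \<partial>S)"
      unfolding psum_Suc_shift suffix head by (simp add: add.commute)
  qed (rule mc; measurable)
  have "(\<integral>\<^sup>+\<omega>. f (npos \<omega> (Suc n)) (psum \<omega> (Suc n)) \<partial>S)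
      = (\<integral>\<^sup>+\<omega>. f1 (npos \<omega> n) (psum \<omega> (Suc n)) + f2 (npos \<omega> n) (psum \<omega> (Suc n)) \<partial>S)"
    by (intro nn_integral_cong) (simp add: npos_Suc f1_def f2_def)
  also have "\<dots> = (\<integral>\<^sup>+\<omega>. f1 (npos \<omega> n) (psum \<omega> (Suc n)) \<partial>S) + (\<integral>\<^sup>+\<omega>. f2 (npos \<omega> n) (psum \<omega> (Suc n)) \<partial>S)"
    by (intro nn_integral_add mc) measurable
  also have "(\<integral>\<^sup>+\<omega>. f1 (npos \<omega> n) (psum \<omega> (Suc n)) \<partial>S) = (\<integral>\<^sup>+\<omega>. f1 (first_max \<omega> n) (psum \<omega> (Suc n)) \<partial>S)"
    by (subst (1 2) nn_integral_last_step) (auto intro: npos_cong first_max_cong simp: IH)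
  also have "(\<integral>\<^sup>+\<omega>. f2 (npos \<omega> n) (psum \<omega> (Suc n)) \<partial>S)
      = (\<integral>\<^sup>+\<omega>. f2 (first_max (\<lambda>i. \<omega> (Suc i)) n) (psum \<omega> (Suc n)) \<partial>S)"
    unfolding shift by (subst nn_integral_last_step) (auto intro: npos_cong simp: IH)
  also have "(\<integral>\<^sup>+\<omega>. f1 (first_max \<omega> n) (psum \<omega> (Suc n)) \<partial>S)
      + (\<integral>\<^sup>+\<omega>. f2 (first_max (\<lambda>i. \<omega> (Suc i)) n) (psum \<omega> (Suc n)) \<partial>S)
      = (\<integral>\<^sup>+\<omega>. f1 (first_max \<omega> n) (psum \<omega> (Suc n)) + f2 (first_max (\<lambda>i. \<omega> (Suc i)) n) (psum \<omega> (Suc n)) \<partial>S)"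
    by (intro nn_integral_add[symmetric] mc) measurable
  also have "\<dots> = (\<integral>\<^sup>+\<omega>. f (first_max \<omega> (Suc n)) (psum \<omega> (Suc n)) \<partial>S)"
    by (intro nn_integral_cong) (simp add: f1_def f2_def)
  finally show ?case .
qed

section \<open>The law of the number of positive partial sums and its binomial moments\<close>

lemma events_npos [measurable, simp]: "{\<omega>. npos \<omega> n = k} \<in> P.events"
  using measurable_sets[OF measurable_npos, of "{k}" n] by (simp add: vimage_def)

lemma events_first_max [measurable, simp]: "{\<omega>. first_max \<omega> n = k} \<in> P.events"
  using measurable_sets[OF measurable_first_max, of "{k}" n] by (simp add: vimage_def)

lemma prob_npos_eq_first_max: "P.prob {\<omega>. npos \<omega> n = k} = P.prob {\<omega>. first_max \<omega> n = k}"
proof -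
  have "emeasure S {\<omega>. npos \<omega> n = k} = (\<integral>\<^sup>+\<omega>. indicator {\<omega>. npos \<omega> n = k} \<omega> \<partial>S)"
    by simp
  also have "\<dots> = (\<integral>\<^sup>+\<omega>. (if npos \<omega> n = k then 1 else 0) \<partial>S)"
    by (intro nn_integral_cong) (simp add: indicator_def)
  also have "\<dots> = (\<integral>\<^sup>+\<omega>. (if first_max \<omega> n = k then 1 else 0) \<partial>S)"
    by (rule sparre_andersen[of "\<lambda>j s. if j = k then 1 else 0"]) auto
  also have "\<dots> = (\<integral>\<^sup>+\<omega>. indicator {\<omega>. first_max \<omega> n = k} \<omega> \<partial>S)"
    by (intro nn_integral_cong) (simp add: indicator_def)
  also have "\<dots> = emeasure S {\<omega>. first_max \<omega> n = k}"
    by simp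
  finally show ?thesis by (simp add: measure_def)
qed

text \<open>After splicing, the indicator of the event is a product of a function of the prefix and
  a function of the suffix by \<open>first_max_split\<close>, and the suffix is distributed like the
  whole walk.\<close>

lemma prob_first_max_split:
  assumes "k \<le> n"
  shows "P.prob {\<omega>. first_max \<omega> n = k}
    = P.prob {\<omega>. first_max \<omega> k = k} * P.prob {\<omega>. first_max \<omega> (n - k) = 0}"
proof -
  have split: "first_max (comb_seq k \<omega> \<omega>') n = k \<longleftrightarrow>
      first_max \<omega> k = k \<and> first_max \<omega>' (n - k) = 0" for \<omega> \<omega>'
    using first_max_cong[of k "comb_seq k \<omega> \<omega>'" \<omega>]
    by (simp add: first_max_split[OF assms] comb_seq_prefix comb_seq_suffix)
  have "emeasure S {\<omega>. first_max \<omega> n = k} = (\<integral>\<^sup>+\<omega>. indicator {\<omega>. first_max \<omega> n = k} \<omega> \<partial>S)"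
    by simp
  also have "\<dots> = (\<integral>\<^sup>+\<omega>. \<integral>\<^sup>+\<omega>'. indicator {\<omega>. first_max \<omega> k = k} \<omega> * indicator {\<omega>. first_max \<omega> (n - k) = 0} \<omega>' \<partial>S \<partial>S)"
    by (subst nn_integral_comb_seq(1)[where k=k])
      (auto intro!: nn_integral_cong simp: split indicator_def)
  also have "\<dots> = emeasure S {\<omega>. first_max \<omega> k = k} * emeasure S {\<omega>. first_max \<omega> (n - k) = 0}"
    by (simp add: nn_integral_cmult nn_integral_multc)
  finally show ?thesis
    by (simp add: P.emeasure_eq_measure ennreal_mult'[symmetric])
qed

lemma distr_uminus_walk: "distr S S (\<lambda>\<omega> i. - \<omega> i) = S"
proof (rule PiM_eq)
  have [measurable]: "(\<lambda>\<omega> i. - \<omega> i) \<in> S \<rightarrow>\<^sub>M S"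
    by (rule measurable_PiM_single') auto
  fix J :: "nat set" and E :: "nat \<Rightarrow> real set"
  assume J: "finite J" "J \<subseteq> UNIV" "\<And>j. j \<in> J \<Longrightarrow> E j \<in> sets M"
  have neg: "uminus -` A \<in> sets M" "emeasure M (uminus -` A) = emeasure M A" if A: "A \<in> sets M" for A
  proof -
    have [measurable]: "A \<in> sets borel" using A by simp
    show "uminus -` A \<in> sets M" using measurable_sets[of uminus borel borel A] by simp
    have "emeasure M A = emeasure (distr M borel uminus) A" by (simp add: symmetric)
    also have "\<dots> = emeasure M (uminus -` A)"
      by (subst emeasure_distr) auto
    finally show "emeasure M (uminus -` A) = emeasure M A" by simp
  qed
  have "emeasure (distr S S (\<lambda>\<omega> i. - \<omega> i)) (prod_emb UNIV (\<lambda>_. M) J (Pi\<^sub>E J E))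
      = emeasure S ((\<lambda>\<omega> i. - \<omega> i) -` prod_emb UNIV (\<lambda>_. M) J (Pi\<^sub>E J E))"
    using J by (subst emeasure_distr) (auto intro!: sets_PiM_I)
  also have "(\<lambda>\<omega> i. - \<omega> i) -` prod_emb UNIV (\<lambda>_. M) J (Pi\<^sub>E J E)
      = prod_emb UNIV (\<lambda>_. M) J (Pi\<^sub>E J (\<lambda>j. uminus -` E j))"
    by (auto simp: prod_emb_def PiE_iff)
  also have "emeasure S \<dots> = (\<Prod>j\<in>J. emeasure M (uminus -` E j))"
    using J neg by (intro emeasure_PiM_emb) auto
  also have "\<dots> = (\<Prod>j\<in>J. emeasure M (E j))"
    using J neg by (intro prod.cong) auto
  finally show "emeasure (distr S S (\<lambda>\<omega> i. - \<omega> i)) (prod_emb UNIV (\<lambda>_. M) J (Pi\<^sub>E J E))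
    = (\<Prod>j\<in>J. emeasure M (E j))" .
qed simp

text \<open>With the first \<open>n\<close> steps fixed, the sum vanishes only if the last step hits
  the single point \<open>- psum \<omega> n\<close>, which has mass zero. Fubini exchanges the order
  so that the last step is integrated first.\<close>

lemma AE_psum_nonzero: "AE \<omega> in S. psum \<omega> (Suc n) \<noteq> 0"
proof -
  have "(\<integral>\<^sup>+\<omega>. indicator {0} (psum \<omega> (Suc n)) \<partial>S)
      = (\<integral>\<^sup>+\<omega>'. (\<integral>\<^sup>+\<omega>. indicator {0} (psum \<omega> n + \<omega>' 0) \<partial>S) \<partial>S)"
    by (rule nn_integral_last_step[where g="\<lambda>_. 0" and f="\<lambda>_. indicator {0}"]) auto
  also have "\<dots> = (\<integral>\<^sup>+\<omega>. (\<integral>\<^sup>+\<omega>'. indicator {0} (psum \<omega> n + \<omega>' 0) \<partial>S) \<partial>S)"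
  proof -
    interpret SS: pair_sigma_finite S S ..
    show ?thesis by (rule SS.Fubini') measurable
  qed
  also have "\<dots> = (\<integral>\<^sup>+\<omega>. 0 \<partial>S)"
  proof (rule nn_integral_cong)
    fix \<omega> :: "nat \<Rightarrow> real"
    have "(\<integral>\<^sup>+\<omega>'. indicator {0} (psum \<omega> n + \<omega>' 0) \<partial>S) = (\<integral>\<^sup>+\<omega>'. indicator {- psum \<omega> n} (\<omega>' 0) \<partial>S)"
      by (intro nn_integral_cong) (auto simp: indicator_def)
    also have "\<dots> = (\<integral>\<^sup>+x. indicator {- psum \<omega> n} x \<partial>distr S M (\<lambda>\<omega>'. \<omega>' 0))"
      by (rule nn_integral_distr[symmetric]) auto
    also have "distr S M (\<lambda>\<omega>'. \<omega>' 0) = M"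
      by (rule PiM_component) simp
    also have "(\<integral>\<^sup>+x. indicator {- psum \<omega> n} x \<partial>M) = 0"
      by (simp add: atomless)
    finally show "(\<integral>\<^sup>+\<omega>'. indicator {0} (psum \<omega> n + \<omega>' 0) \<partial>S) = (0::ennreal)" .
  qed
  finally have "(\<integral>\<^sup>+\<omega>. indicator {0} (psum \<omega> (Suc n)) \<partial>S) = 0" by simp
  then have "AE \<omega> in S. indicator {0} (psum \<omega> (Suc n)) = (0::ennreal)"
    by (subst (asm) nn_integral_0_iff_AE) auto
  then show ?thesis by eventually_elim (auto simp: indicator_def)
qed

text \<open>Reflection, which costs nothing as ties with \<open>0\<close> have probability zero.\<close>

lemma prob_npos_extremes: "P.prob {\<omega>. npos \<omega> n = 0} = P.prob {\<omega>. npos \<omega> n = n}"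
proof -
  have [measurable]: "(\<lambda>\<omega> i. - \<omega> i) \<in> S \<rightarrow>\<^sub>M S"
    by (rule measurable_PiM_single') auto
  have neg: "psum (\<lambda>i. - \<omega> i) k = - psum \<omega> k" for \<omega> k
    by (simp add: psum_def sum_negf)
  have "P.prob {\<omega>. npos \<omega> n = 0} = measure (distr S S (\<lambda>\<omega> i. - \<omega> i)) {\<omega>. npos \<omega> n = 0}"
    by (simp add: distr_uminus_walk)
  also have "\<dots> = P.prob {\<omega>. npos (\<lambda>i. - \<omega> i) n = 0}"
    by (subst measure_distr) (auto simp: vimage_def)
  also have "\<dots> = P.prob {\<omega>. npos \<omega> n = n}"
  proof (rule P.finite_measure_eq_AE)
    have "AE \<omega> in S. \<forall>k<n. psum \<omega> (Suc k) \<noteq> 0"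
      by (intro AE_all_countable[THEN iffD2] allI AE_impI AE_psum_nonzero)
    then show "AE \<omega> in S. \<omega> \<in> {\<omega>. npos (\<lambda>i. - \<omega> i) n = 0} \<longleftrightarrow> \<omega> \<in> {\<omega>. npos \<omega> n = n}"
      by eventually_elim (auto simp: npos_eq_0_iff npos_eq_n_iff neg less_le)
    show "{\<omega>. npos (\<lambda>i. - \<omega> i) n = 0} \<in> P.events"
      using measurable_sets[of "\<lambda>\<omega> i. - \<omega> i" S S "{\<omega>. npos \<omega> n = 0}"] by (simp add: vimage_def)
  qed measurable
  finally show ?thesis .
qed

text \<open>By Sparre Andersen and reflection, a maximum at \<open>0\<close> and a maximum at
  \<open>n\<close> have the same probability \<open>p n\<close>. So the first maximum has law
  \<open>p k * p (n - k)\<close>, and total mass 1 is precisely the equation solved by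
  \<open>arc_coeff_unique\<close>.\<close>

lemma prob_npos:
  assumes "k \<le> n"
  shows "P.prob {\<omega>. npos \<omega> n = k} = arc_coeff k * arc_coeff (n - k)"
proof -
  define p where "p n = P.prob {\<omega>. first_max \<omega> n = n}" for n
  have 0: "P.prob {\<omega>. first_max \<omega> n = 0} = p n" for n
    using prob_npos_extremes[of n] prob_npos_eq_first_max[of n 0] prob_npos_eq_first_max[of n n]
    by (simp add: p_def)
  have split: "P.prob {\<omega>. first_max \<omega> n = k} = p k * p (n - k)" if "k \<le> n" for k n
    using prob_first_max_split[OF that] by (simp add: 0 flip: p_def)
  have "p n = arc_coeff n" for n
  proof (rule arc_coeff_unique)
    fix n
    have "(\<Sum>k\<le>n. p k * p (n - k)) = (\<Sum>k\<le>n. P.prob {\<omega>. first_max \<omega> n = k})"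
      by (intro sum.cong) (auto simp: split)
    also have "\<dots> = P.prob (\<Union>k\<le>n. {\<omega>. first_max \<omega> n = k})"
      by (intro P.finite_measure_finite_Union[symmetric])
        (auto simp: disjoint_family_on_def)
    also have "(\<Union>k\<le>n. {\<omega>. first_max \<omega> n = k}) = space S"
      using first_max_properties by auto
    finally show "(\<Sum>k\<le>n. p k * p (n - k)) = 1" using P.prob_space by simp
  qed (simp add: p_def)
  then show ?thesis using split[OF assms] prob_npos_eq_first_max by simp
qed

text \<open>Binomial moments are preferred to powers because \<open>arc_coeff_convolution\<close>
  evaluates them exactly for finite \<open>n\<close>.\<close>

lemma expectation_npos_binomial:
  assumes "j \<le> n"
  shows "(\<integral>\<omega>. real (npos \<omega> n choose j) \<partial>S) = arc_coeff j * real (n choose j)"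
proof -
  have eq: "real (npos \<omega> n choose j) = (\<Sum>k\<le>n. real (k choose j) * indicator {\<omega>. npos \<omega> n = k} \<omega>)" for \<omega>
  proof -
    have "(\<Sum>k\<le>n. real (k choose j) * indicator {\<omega>. npos \<omega> n = k} \<omega>)
        = (\<Sum>k\<in>{npos \<omega> n}. real (k choose j) * indicator {\<omega>. npos \<omega> n = k} \<omega>)"
      using npos_le[of \<omega> n] by (intro sum.mono_neutral_right) (auto simp: indicator_def)
    then show ?thesis by simp
  qed
  have "(\<integral>\<omega>. real (npos \<omega> n choose j) \<partial>S)
      = (\<Sum>k\<le>n. real (k choose j) * P.prob {\<omega>. npos \<omega> n = k})"
    unfolding eq by (subst Bochner_Integration.integral_sum) (auto simp: P.emeasure_eq_measure)
  also have "\<dots> = (\<Sum>k\<le>n. real (k choose j) * (arc_coeff k * arc_coeff (n - k)))"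
    by (intro sum.cong) (auto simp: prob_npos)
  finally show ?thesis using arc_coeff_convolution[OF assms] by simp
qed

end

subsection \<open>The arcsine distribution\<close>

text \<open>The substitution \<open>s = t * u\<close> produces the Beta integral with parameters
  \<open>j + 1/2\<close> and \<open>1/2\<close>, which the Gamma function evaluates as
  \<open>pi * arc_coeff j\<close>. The case \<open>j = 0\<close> will show that the density has
  total mass 1.\<close>

lemma arcsine_moment_nn_integral:
  assumes t: "0 < t"
  shows "(\<integral>\<^sup>+s. ennreal (s ^ j * sojourn_density t s) \<partial>lborel) = ennreal (t ^ j * arc_coeff j)"
proof -
  have Beta_eq: "Beta (real j + 1/2) (1/2) = pi * arc_coeff j"
  proof -
    have "(1/2::real) \<notin> \<int>\<^sub>\<le>\<^sub>0"
      using nonpos_Ints_nonpos[of "1/2::real"] by auto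
    then have "Gamma (real j + 1/2) = pochhammer (1/2) j * sqrt pi"
      using pochhammer_Gamma[of "1/2::real" j] by (simp add: Gamma_one_half_real add.commute)
    moreover have "Gamma (real j + 1) = fact j"
      by (simp add: Gamma_fact add.commute)
    ultimately show ?thesis
      by (simp add: Beta_def Gamma_one_half_real arc_coeff_def add.commute mult.commute mult.left_commute)
  qed
  define g where "g u = u powr (real j + 1/2 - 1) * (1 - u) powr (1/2 - 1)" for u :: real
  have g_nonneg: "0 \<le> g u" for u by (simp add: g_def)
  have unit: "(\<integral>\<^sup>+u. ennreal (indicator {0..1} u * g u) \<partial>lborel) = ennreal (pi * arc_coeff j)"
  proof -
    have "(g has_integral Beta (real j + 1/2) (1/2)) {0..1}"
      unfolding g_def by (rule has_integral_Beta_real) auto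
    then have "(\<integral>\<^sup>+u. ennreal (g u) * indicator {0..1} u \<partial>lborel) = ennreal (pi * arc_coeff j)"
      unfolding Beta_eq by (intro nn_integral_has_integral_lebesgue') (simp_all add: g_nonneg)
    moreover have "(\<integral>\<^sup>+u. ennreal (indicator {0..1} u * g u) \<partial>lborel)
        = (\<integral>\<^sup>+u. ennreal (g u) * indicator {0..1} u \<partial>lborel)"
      by (intro nn_integral_cong) (simp add: indicator_def)
    ultimately show ?thesis by simp
  qed
  have "(\<integral>\<^sup>+s. ennreal (s ^ j * sojourn_density t s) \<partial>lborel)
      = \<bar>t\<bar> * (\<integral>\<^sup>+u. ennreal ((0 + t * u) ^ j * sojourn_density t (0 + t * u)) \<partial>lborel)"
    using t by (intro nn_integral_real_affine) (auto simp: sojourn_density_def)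
  also have "(\<integral>\<^sup>+u. ennreal ((0 + t * u) ^ j * sojourn_density t (0 + t * u)) \<partial>lborel)
      = (\<integral>\<^sup>+u. ennreal (t ^ j / (t * pi)) * ennreal (indicator {0..1} u * g u) \<partial>lborel)"
  proof (rule nn_integral_cong_AE)
    have "AE u in lborel. u \<notin> {0, 1::real}"
      by (intro AE_not_in countable_imp_null_set_lborel) auto
    then show "AE u in lborel. ennreal ((0 + t * u) ^ j * sojourn_density t (0 + t * u))
        = ennreal (t ^ j / (t * pi)) * ennreal (indicator {0..1} u * g u)"
    proof eventually_elim
      case (elim u)
      show ?case
      proof (cases "0 < u \<and> u < 1")
        case True
        have half: "w powr - (1/2) = 1 / sqrt w" if "0 < w" for w :: real
          using that by (simp add: powr_minus powr_half_sqrt inverse_eq_divide)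
        have "u powr (real j + 1/2 - 1) = u powr real j * u powr - (1/2)"
          by (simp flip: powr_add)
        also have "\<dots> = u ^ j / sqrt u"
          using True half[of u] by (simp add: powr_realpow)
        finally have "g u = u ^ j / (sqrt u * sqrt (1 - u))"
          using True half[of "1 - u"] by (simp add: g_def)
        moreover have "sqrt (t * u * (t - t * u)) = t * (sqrt u * sqrt (1 - u))"
        proof -
          have eq: "t * u * (t - t * u) = t\<^sup>2 * (u * (1 - u))" by (simp add: power2_eq_square algebra_simps)
          show ?thesis unfolding eq using t by (simp add: real_sqrt_mult)
        qed
        moreover have "sojourn_density t (t * u) = 1 / (pi * sqrt (t * u * (t - t * u)))"
          using True t by (simp add: sojourn_density_def)
        ultimately have "(t * u) ^ j * sojourn_density t (t * u) = t ^ j / (t * pi) * g u"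
          by (simp add: power_mult_distrib mult.commute)
        then show ?thesis using True t by (simp add: ennreal_mult'[symmetric])
      next
        case False
        then have "u < 0 \<or> 1 < u" using elim by auto
        then show ?thesis using t by (auto simp: sojourn_density_def zero_less_mult_iff)
      qed
    qed
  qed
  also have "\<dots> = ennreal (t ^ j / (t * pi)) * ennreal (pi * arc_coeff j)"
    unfolding unit[symmetric] by (rule nn_integral_cmult) (simp add: g_def)
  also have "ennreal \<bar>t\<bar> * \<dots> = ennreal (t ^ j * arc_coeff j)"
    using t by (simp add: ennreal_mult'[symmetric] arc_coeff_def pochhammer_nonneg)
  finally show ?thesis .
qed

definition arcsine_distribution :: "real \<Rightarrow> real measure" where
  "arcsine_distribution t = density lborel (\<lambda>s. ennreal (sojourn_density t s))"

lemma measurable_sojourn_density [measurable]: "sojourn_density t \<in> borel_measurable borel"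
  unfolding sojourn_density_def by measurable

lemma sojourn_density_nonneg: "0 \<le> sojourn_density t s"
  by (simp add: sojourn_density_def)

lemma arc_coeff_nonneg: "0 \<le> arc_coeff j"
  by (simp add: arc_coeff_def pochhammer_nonneg)

lemma real_distribution_arcsine:
  assumes "0 < t"
  shows "real_distribution (arcsine_distribution t)"
proof -
  have "prob_space (arcsine_distribution t)"
    using arcsine_moment_nn_integral[OF assms, of 0]
    by (intro prob_spaceI) (simp add: arcsine_distribution_def emeasure_density arc_coeff_def)
  then show ?thesis
    by (simp add: real_distribution_def real_distribution_axioms_def arcsine_distribution_def)
qed

lemma AE_arcsine_bounded: "AE s in arcsine_distribution t. \<bar>s\<bar> \<le> t"
proof -
  have "AE s in lborel. 0 < ennreal (sojourn_density t s) \<longrightarrow> \<bar>s\<bar> \<le> t"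
    by (intro AE_I2) (simp add: sojourn_density_def)
  then show ?thesis
    unfolding arcsine_distribution_def by (subst AE_density) (auto intro: measurable_compose[OF measurable_sojourn_density])
qed

lemma arcsine_moment:
  assumes "0 < t"
  shows "(\<integral>s. s ^ j \<partial>arcsine_distribution t) = t ^ j * arc_coeff j"
proof -
  have "(\<integral>s. s ^ j \<partial>arcsine_distribution t) = (\<integral>s. sojourn_density t s * s ^ j \<partial>lborel)"
    unfolding arcsine_distribution_def
    by (subst integral_density) (auto simp: sojourn_density_nonneg)
  also have "\<dots> = enn2real (\<integral>\<^sup>+s. ennreal (s ^ j * sojourn_density t s) \<partial>lborel)"
    by (subst integral_eq_nn_integral) (auto simp: sojourn_density_def mult.commute)
  also have "\<dots> = t ^ j * arc_coeff j"
    using assms by (simp add: arcsine_moment_nn_integral arc_coeff_nonneg)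
  finally show ?thesis .
qed

text \<open>The exponential series may be integrated termwise, being dominated by the series of
  \<open>exp (norm z * C)\<close>. A complex \<open>z\<close> covers both the characteristic
  function, with imaginary \<open>z\<close>, and the Laplace transform, with
  \<open>z = - lam\<close>.\<close>

lemma (in prob_space) exp_moment_sums:
  fixes X :: "'a \<Rightarrow> real" and z :: complex
  assumes [measurable]: "random_variable borel X" and bound: "AE \<omega> in M. \<bar>X \<omega>\<bar> \<le> C"
  shows "(\<lambda>k. z ^ k * of_real (expectation (\<lambda>\<omega>. X \<omega> ^ k)) / fact k)
    sums (\<integral>\<omega>. exp (z * of_real (X \<omega>)) \<partial>M)"
proof -
  define f where "f k \<omega> = (z * of_real (X \<omega>)) ^ k /\<^sub>R fact k" for k \<omega>
  have C: "0 \<le> C"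
  proof -
    have "AE \<omega> in M. 0 \<le> C" using bound by eventually_elim auto
    then show ?thesis by simp
  qed
  have norm_f: "norm (f k \<omega>) \<le> (norm z * C) ^ k / fact k" if "\<bar>X \<omega>\<bar> \<le> C" for k \<omega>
  proof -
    have "norm (z * of_real (X \<omega>)) \<le> norm z * C"
      using that by (simp add: norm_mult mult_left_mono)
    then show ?thesis
      by (simp add: f_def norm_power divide_inverse mult.commute power_mono mult_left_mono)
  qed
  have int: "integrable M (f k)" for k
  proof (rule integrable_const_bound[where B="(norm z * C) ^ k / fact k"])
    show "AE \<omega> in M. norm (f k \<omega>) \<le> (norm z * C) ^ k / fact k"
      using bound by eventually_elim (rule norm_f)
    show "random_variable borel (f k)" unfolding f_def by measurable
  qed
  have summable_exp: "summable (\<lambda>k. (norm z * C) ^ k / fact k)"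
    using summable_exp[of "norm z * C"] by (simp add: divide_inverse mult.commute)
  have "(\<lambda>k. integral\<^sup>L M (f k)) sums (\<integral>\<omega>. (\<Sum>k. f k \<omega>) \<partial>M)"
  proof (rule sums_integral[OF int])
    show "AE \<omega> in M. summable (\<lambda>k. norm (f k \<omega>))"
      using bound
    proof eventually_elim
      case (elim \<omega>)
      then show ?case using norm_f by (intro summable_comparison_test'[OF summable_exp]) auto
    qed
    show "summable (\<lambda>k. \<integral>\<omega>. norm (f k \<omega>) \<partial>M)"
    proof (rule summable_comparison_test'[OF summable_exp])
      fix k
      have "(\<integral>\<omega>. norm (f k \<omega>) \<partial>M) \<le> (\<integral>\<omega>. (norm z * C) ^ k / fact k \<partial>M)"
        using bound int[of k] by (intro integral_mono_AE) (auto elim!: eventually_mono intro: norm_f)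
      then show "norm (\<integral>\<omega>. norm (f k \<omega>) \<partial>M) \<le> (norm z * C) ^ k / fact k"
        by (simp add: prob_space)
    qed
  qed
  moreover have "integral\<^sup>L M (f k) = z ^ k * of_real (expectation (\<lambda>\<omega>. X \<omega> ^ k)) / fact k" for k
  proof -
    have "f k = (\<lambda>\<omega>. (z ^ k / fact k) * of_real (X \<omega> ^ k))"
      by (simp add: f_def fun_eq_iff power_mult_distrib scaleR_conv_of_real divide_inverse mult_ac)
    then show ?thesis by (simp add: integral_complex_of_real del: of_real_power)
  qed
  ultimately show ?thesis by (simp add: f_def exp_def)
qed

text \<open>Both characteristic functions are sums of the same moment series by
  \<open>exp_moment_sums\<close>, so Levy's uniqueness theorem identifies the distributions.\<close>

lemma (in prob_space) distributed_arcsine: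
  assumes t: "0 < t" and rv [measurable]: "random_variable borel X"
    and bound: "AE \<omega> in M. \<bar>X \<omega>\<bar> \<le> C"
    and moments: "\<And>j. expectation (\<lambda>\<omega>. X \<omega> ^ j) = t ^ j * arc_coeff j"
  shows "distributed M lborel X (sojourn_density t)"
proof -
  have "distr M borel X = arcsine_distribution t"
  proof (rule Levy_uniqueness)
    show "real_distribution (distr M borel X)" by simp
    interpret A: real_distribution "arcsine_distribution t"
      using t by (rule real_distribution_arcsine)
    show "real_distribution (arcsine_distribution t)" ..
    show "char (distr M borel X) = char (arcsine_distribution t)"
    proof
      fix u
      have "(\<lambda>k. (\<i> * of_real u) ^ k * of_real (t ^ k * arc_coeff k) / fact k)
          sums (\<integral>\<omega>. exp (\<i> * of_real u * of_real (X \<omega>)) \<partial>M)"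
        using exp_moment_sums[OF rv bound, of "\<i> * of_real u"] by (simp add: moments)
      moreover have "(\<lambda>k. (\<i> * of_real u) ^ k * of_real (t ^ k * arc_coeff k) / fact k)
          sums (\<integral>s. exp (\<i> * of_real u * of_real s) \<partial>arcsine_distribution t)"
        using A.exp_moment_sums[of "\<lambda>s. s" t "\<i> * of_real u"] t
        by (simp add: arcsine_moment AE_arcsine_bounded)
      ultimately have "(\<integral>\<omega>. exp (\<i> * of_real u * of_real (X \<omega>)) \<partial>M)
          = (\<integral>s. exp (\<i> * of_real u * of_real s) \<partial>arcsine_distribution t)"
        by (rule sums_unique2)
      then show "char (distr M borel X) u = char (arcsine_distribution t) u"
        by (simp add: char_def integral_distr mult.assoc)
    qed
  qed
  then show ?thesis
    by (simp add: distributed_def arcsine_distribution_def cong: distr_cong)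
qed

subsection \<open>Sojourn times as limits of walks\<close>

lemma symmetric_walk_normal:
  assumes \<sigma>: "0 < \<sigma>"
  shows "symmetric_walk (density lborel (normal_density 0 \<sigma>))"
proof -
  let ?M = "density lborel (normal_density 0 \<sigma>)"
  interpret prob_space ?M by (rule prob_space_normal_density) fact
  have "density (distr lborel borel uminus) (normal_density 0 \<sigma>)
      = distr (density lborel (\<lambda>x. normal_density 0 \<sigma> (- x))) borel uminus"
    by (rule density_distr) auto
  then have "distr ?M borel uminus = ?M"
    by (simp add: lborel_distr_uminus normal_density_def)
  moreover have "emeasure ?M {x} = 0" for x
    by (subst emeasure_density) auto
  moreover have "product_prob_space (\<lambda>_::nat. ?M)"
    by (rule product_prob_spaceI) (rule prob_space_axioms)
  ultimately show ?thesis
    by (simp add: symmetric_walk_def sequence_space_def symmetric_walk_axioms_def)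
qed

text \<open>Rounding the time down to a grid of mesh \<open>1 / (n + 1)\<close> leaves countably
  many times, hence a jointly measurable function, and path continuity gives pointwise convergence.
  \<open>max 0\<close> freezes the process at negative times, where \<open>B\<close> is
  unconstrained.\<close>

lemma measurable_continuous_paths:
  fixes B :: "real \<Rightarrow> 'b \<Rightarrow> real"
  assumes meas: "\<And>t. 0 \<le> t \<Longrightarrow> B t \<in> borel_measurable V"
    and cont: "\<And>\<omega>. \<omega> \<in> space V \<Longrightarrow> continuous_on {0..} (\<lambda>t. B t \<omega>)"
  shows "(\<lambda>p. B (max 0 (snd p)) (fst p)) \<in> borel_measurable (V \<Otimes>\<^sub>M borel)"
proof (rule borel_measurable_LIMSEQ_metric)
  define grid where "grid n s = real (nat \<lfloor>real (Suc n) * max 0 s\<rfloor>) / real (Suc n)" for n and s :: real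
  show "(\<lambda>p. B (grid n (snd p)) (fst p)) \<in> borel_measurable (V \<Otimes>\<^sub>M borel)" for n
    unfolding grid_def
  proof (rule measurable_compose_countable[where g="\<lambda>p. nat \<lfloor>real (Suc n) * max 0 (snd p)\<rfloor>"])
    show "(\<lambda>p. B (real i / real (Suc n)) (fst p)) \<in> borel_measurable (V \<Otimes>\<^sub>M borel)" for i
      using meas by (intro measurable_compose[OF measurable_fst]) auto
  qed measurable
  fix p :: "'b \<times> real" assume p: "p \<in> space (V \<Otimes>\<^sub>M borel)"
  define s where "s = max 0 (snd p)"
  have grid_bounds: "0 \<le> grid n (snd p)" "grid n (snd p) \<le> s" "s - 1 / real (Suc n) \<le> grid n (snd p)" for n
  proof -
    have nonneg: "0 \<le> real (Suc n) * s" by (simp add: s_def)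
    then have "real (nat \<lfloor>real (Suc n) * s\<rfloor>) = of_int \<lfloor>real (Suc n) * s\<rfloor>" by simp
    then have eq: "grid n (snd p) = of_int \<lfloor>real (Suc n) * s\<rfloor> / real (Suc n)"
      unfolding grid_def s_def by simp
    show "grid n (snd p) \<le> s"
      unfolding eq by (subst pos_divide_le_eq, simp, simp add: mult.commute del: of_nat_Suc)
    have "(s - 1 / real (Suc n)) * real (Suc n) \<le> of_int \<lfloor>real (Suc n) * s\<rfloor>"
      unfolding left_diff_distrib mult.commute[of s] by (simp del: of_nat_Suc)
    then show "s - 1 / real (Suc n) \<le> grid n (snd p)"
      unfolding eq by (subst pos_le_divide_eq) (simp_all del: of_nat_Suc)
    show "0 \<le> grid n (snd p)" by (simp add: grid_def)
  qed
  have "(\<lambda>n. grid n (snd p)) \<longlonglongrightarrow> s"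
  proof (rule tendsto_sandwich)
    show "(\<lambda>n. s - 1 / real (Suc n)) \<longlonglongrightarrow> s"
      using tendsto_diff[OF tendsto_const[of s] LIMSEQ_inverse_real_of_nat] by (simp add: inverse_eq_divide)
  qed (use grid_bounds in auto)
  then show "(\<lambda>n. B (grid n (snd p)) (fst p)) \<longlonglongrightarrow> B (max 0 (snd p)) (fst p)"
    unfolding s_def[symmetric] using p
    by (intro continuous_on_tendsto_compose[OF cont]) (auto simp: space_pair_measure grid_bounds s_def)
qed

lemma sojourn_pos_eq:
  "sojourn_pos B t \<omega> = measure lborel {s. 0 \<le> s \<and> s < t \<and> 0 < B (max 0 s) \<omega>}"
  unfolding sojourn_pos_def by (intro arg_cong[where f="measure lborel"]) (auto simp: max_def)

text \<open>The space \<open>V\<close> is arbitrary because two choices occur: \<open>M\<close>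
  itself, and the sigma-algebra generated by the path alone, which carries the independence from
  \<open>U\<close>.\<close>

lemma measurable_sojourn_pos:
  fixes B :: "real \<Rightarrow> 'b \<Rightarrow> real"
  assumes meas: "\<And>t. 0 \<le> t \<Longrightarrow> B t \<in> borel_measurable V"
    and cont: "\<And>\<omega>. \<omega> \<in> space V \<Longrightarrow> continuous_on {0..} (\<lambda>t. B t \<omega>)"
  shows "sojourn_pos B t \<in> borel_measurable V"
proof -
  define Q where "Q = {p \<in> space (V \<Otimes>\<^sub>M lborel). 0 \<le> snd p \<and> snd p < t \<and> 0 < B (max 0 (snd p)) (fst p)}"
  have [measurable]: "(\<lambda>p. B (max 0 (snd p)) (fst p)) \<in> borel_measurable (V \<Otimes>\<^sub>M lborel)"
    using measurable_continuous_paths[of B V, OF meas cont]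
    by (simp cong: measurable_cong_sets sets_pair_measure_cong)
  have Q: "Q \<in> sets (V \<Otimes>\<^sub>M lborel)"
    unfolding Q_def by measurable
  have "(\<lambda>\<omega>. measure lborel (Pair \<omega> -` Q)) \<in> borel_measurable V"
    unfolding measure_def using lborel.measurable_emeasure_Pair[OF Q] by measurable
  then show ?thesis
    by (rule measurable_cong[THEN iffD1, rotated])
      (auto simp: sojourn_pos_eq Q_def space_pair_measure intro!: arg_cong[where f="measure lborel"])
qed

lemma sojourn_pos_bounds:
  assumes "0 \<le> t"
  shows "\<bar>sojourn_pos B t \<omega>\<bar> \<le> t"
proof -
  let ?A = "{s. 0 \<le> s \<and> s < t \<and> 0 < B s \<omega>}"
  show ?thesis
  proof (cases "?A \<in> sets lborel")
    case True
    then have "measure lborel ?A \<le> measure lborel {0..t}"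
      by (intro measure_mono_fmeasurable) (auto simp: fmeasurable_def emeasure_lborel_Icc_eq)
    then show ?thesis using assms by (simp add: sojourn_pos_def)
  next
    \<comment> \<open>Outside the measurable sets \<open>measure\<close> has the default value 0,
      which satisfies the bound.\<close>
    case False
    then show ?thesis using assms by (simp add: sojourn_pos_def measure_notin_sets)
  qed
qed

text \<open>The positivity set of \<open>b\<close> is replaced by the union of the grid cells whose right endpoint
  lies in it; by continuity the indicators converge off the zero set.\<close>

lemma riemann_sum_positive_times:
  fixes b :: "real \<Rightarrow> real"
  assumes t: "0 < t" and cont: "continuous_on {0..} b"
    and null: "AE s in lborel. 0 \<le> s \<longrightarrow> b s \<noteq> 0"
  shows "(\<lambda>n. t / real n * (\<Sum>k<n. of_bool (0 < b (t / real n * real (Suc k)))))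
    \<longlonglongrightarrow> measure lborel {s. 0 \<le> s \<and> s < t \<and> 0 < b s}"
proof -
  define c where "c n k = (of_bool (0 < b (t / real n * real (Suc k))) :: real)" for n k
  define I where "I n k = {t / real n * real k <.. t / real n * real (Suc k)}" for n k
  define G where "G n s = (\<Sum>k<n. c n k * indicator (I n k) s)" for n s
  let ?A = "{s. 0 \<le> s \<and> s < t \<and> 0 < b s}"
  have G_eq: "\<exists>r. s \<le> r \<and> r \<le> s + t / real n \<and> G n s = of_bool (0 < b r)"
    if s: "0 < s" "s \<le> t" and n: "0 < n" for n s
  proof -
    define z where "z = real n * s / t"
    \<comment> \<open>The cells \<open>I n k\<close> contain their right endpoint but not their left
      one, so the rescaled point \<open>z\<close> lies in the cell of index
      \<open>\<lceil>z\<rceil> - 1\<close>.\<close>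
    define k where "k = nat (\<lceil>z\<rceil> - 1)"
    have z: "0 < z" "z \<le> real n" using s n t by (simp_all add: z_def divide_le_eq)
    have sz: "s = t / real n * z" using n t by (simp add: z_def)
    have kz: "real k < z" "z \<le> real (Suc k)" using z(1) unfolding k_def by linarith+
    have "k < n" using kz(1) z(2) by linarith
    have c: "0 < t / real n" using t n by simp
    have mem: "s \<in> I n j \<longleftrightarrow> j = k" for j
    proof -
      have "s \<in> I n j \<longleftrightarrow> real j < z \<and> z \<le> real (Suc j)"
        unfolding I_def sz using c by (simp add: mult_less_cancel_left_pos mult_le_cancel_left_pos del: of_nat_Suc times_divide_eq_left)
      also have "\<dots> \<longleftrightarrow> j = k" using kz by auto
      finally show ?thesis .
    qed
    have "G n s = (\<Sum>j<n. if j = k then c n j else 0)"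
      unfolding G_def by (intro sum.cong) (auto simp: mem)
    then have "G n s = of_bool (0 < b (t / real n * real (Suc k)))"
      using \<open>k < n\<close> by (simp add: c_def del: of_nat_Suc)
    moreover have "s \<le> t / real n * real (Suc k)"
      unfolding sz using c kz by (intro mult_left_mono) auto
    moreover have "t / real n * real (Suc k) \<le> s + t / real n"
    proof -
      have "t / real n * real k \<le> s" unfolding sz using c kz by (intro mult_left_mono) auto
      then show ?thesis by (simp add: algebra_simps add_divide_distrib)
    qed
    ultimately show ?thesis by blast
  qed
  have G_outside: "G n s = 0" if "s \<le> 0 \<or> t < s" for n s
    unfolding G_def
  proof (rule sum.neutral, intro ballI)
    fix k assume k: "k \<in> {..<n}"
    have "s \<notin> I n k"
    proof
      assume s: "s \<in> I n k"
      have "0 \<le> t / real n * real k" using t by simp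
      moreover have "t / real n * real (Suc k) \<le> t / real n * real n"
        using t k by (intro mult_left_mono) auto
      moreover have "t / real n * real n = t" using k by auto
      ultimately show False using s that by (simp add: I_def del: of_nat_Suc)
    qed
    then show "c n k * indicator (I n k) s = 0" by simp
  qed
  have "(\<lambda>n. integral\<^sup>L lborel (G n)) \<longlonglongrightarrow> (\<integral>s. indicator ?A s \<partial>lborel)"
  proof (rule integral_dominated_convergence[where w="indicator {0..t}"])
    have [measurable]: "?A \<in> sets borel"
    proof -
      have "(\<lambda>s. b (max 0 s)) \<in> borel_measurable borel"
        by (intro borel_measurable_continuous_onI continuous_on_compose2[OF cont] continuous_intros) auto
      then have "{s. 0 \<le> s \<and> s < t \<and> 0 < b (max 0 s)} \<in> sets borel" by measurable
      also have "{s. 0 \<le> s \<and> s < t \<and> 0 < b (max 0 s)} = ?A" by (auto simp: max_def)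
      finally show ?thesis .
    qed
    show "(indicator ?A :: real \<Rightarrow> real) \<in> borel_measurable lborel" by measurable
    show "G n \<in> borel_measurable lborel" for n
      unfolding G_def I_def by measurable
    show "integrable lborel (indicator {0..t} :: real \<Rightarrow> real)"
      by (intro integrable_real_indicator) (auto simp: emeasure_lborel_Icc_eq)
    show "AE s in lborel. norm (G n s) \<le> indicator {0..t} s" for n
    proof (intro AE_I2)
      fix s
      show "norm (G n s) \<le> indicator {0..t} s"
      proof (cases "0 < s \<and> s \<le> t \<and> 0 < n")
        case True
        then obtain r where "G n s = of_bool (0 < b r)" using G_eq by blast
        then show ?thesis using True by simp
      next
        case False
        then have "G n s = 0" using G_outside[of s n] by (auto simp: not_less G_def)
        then show ?thesis by simp
      qed
    qed
    have "AE s in lborel. s \<notin> {0, t}" by (intro AE_not_in countable_imp_null_set_lborel) auto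
    with null show "AE s in lborel. (\<lambda>n. G n s) \<longlonglongrightarrow> indicator ?A s"
    proof eventually_elim
      case (elim s)
      show ?case
      proof (cases "0 < s \<and> s < t")
        case False
        with elim have out: "s \<le> 0 \<or> t < s" "s \<notin> ?A" by auto
        then show ?thesis by (simp add: G_outside)
      next
        case True
        then have "\<forall>n. \<exists>r. 0 < n \<longrightarrow> s \<le> r \<and> r \<le> s + t / real n \<and> G n s = of_bool (0 < b r)"
          using G_eq[of s] by (metis less_imp_le)
        then obtain r where r: "\<And>n. 0 < n \<Longrightarrow> s \<le> r n \<and> r n \<le> s + t / real n \<and> G n s = of_bool (0 < b (r n))"
          by metis
        have above: "eventually (\<lambda>n. s \<le> r n) sequentially"
          and below: "eventually (\<lambda>n. r n \<le> s + t / real n) sequentially"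
          using eventually_gt_at_top[of 0] by (eventually_elim, simp add: r)+
        have "(\<lambda>n. s + t / real n) \<longlonglongrightarrow> s"
          using tendsto_add[OF tendsto_const lim_const_over_n[of t], of s] by simp
        then have "r \<longlonglongrightarrow> s"
          by (rule tendsto_sandwich[OF above below tendsto_const])
        then have b: "(\<lambda>n. b (r n)) \<longlonglongrightarrow> b s"
        proof (rule continuous_on_tendsto_compose[OF cont])
          show "s \<in> {0..}" using True by simp
          show "eventually (\<lambda>n. r n \<in> {0..}) sequentially"
            using above by eventually_elim (use True in simp)
        qed
        have "eventually (\<lambda>n. G n s = indicator ?A s) sequentially"
        proof (cases "0 < b s")
          case pos: True
          have "eventually (\<lambda>n. 0 < b (r n)) sequentially" using order_tendstoD(1)[OF b pos] .
          then show ?thesis using eventually_gt_at_top[of 0]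
            by eventually_elim (use True pos r in auto)
        next
          case False
          then have neg: "b s < 0" using elim True by auto
          have "eventually (\<lambda>n. b (r n) < 0) sequentially" using order_tendstoD(2)[OF b neg] .
          then show ?thesis using eventually_gt_at_top[of 0]
            by eventually_elim (use neg r in auto)
        qed
        then show ?thesis by (rule tendsto_eventually)
      qed
    qed
  qed
  moreover have "integral\<^sup>L lborel (G n) = t / real n * (\<Sum>k<n. c n k)" for n
  proof -
    have le: "t / real n * real k \<le> t / real n * real (Suc k)" for k
      using t by (intro mult_left_mono) auto
    have meas: "measure lborel (I n k) = t / real n" for k
      unfolding I_def using le by (subst measure_lborel_Ioc) (auto simp: algebra_simps add_divide_distrib)
    have int: "integrable lborel (indicator (I n k) :: real \<Rightarrow> real)" for k
      unfolding I_def using le[of k] by (intro integrable_real_indicator) (auto simp: emeasure_lborel_Ioc)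
    have "integral\<^sup>L lborel (G n) = (\<Sum>k<n. c n k * (t / real n))"
      unfolding G_def by (subst Bochner_Integration.integral_sum) (auto simp: int meas)
    then show ?thesis by (simp add: sum_distrib_left mult.commute)
  qed
  moreover have "(\<integral>s. indicator ?A s \<partial>lborel) = measure lborel ?A" by simp
  ultimately show ?thesis by (simp add: c_def)
qed

lemma real_binomial_prod: "real (m choose j) * fact j = (\<Prod>i<j. real m - real i)"
  by (simp add: binomial_gbinomial gbinomial_prod_rev lessThan_atLeast0)

section \<open>Brownian motion on a grid as a symmetric walk, and the moments of its sojourn
  time\<close>

context brownian_motion
begin

text \<open>An infinite sequence of increments for each mesh \<open>h\<close>, so that its law lives
  on the sequence space of \<open>symmetric_walk\<close>.\<close>

definition incr :: "real \<Rightarrow> 'a \<Rightarrow> nat \<Rightarrow> real" where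
  "incr h \<omega> i = B (h * real (Suc i)) \<omega> - B (h * real i) \<omega>"

lemma measurable_incr [measurable]: "0 < h \<Longrightarrow> random_variable borel (\<lambda>\<omega>. incr h \<omega> i)"
  unfolding incr_def by (intro borel_measurable_diff random_variable_B) auto

text \<open>Independence of an infinite family is tested on finite index sets, and each of these
  lies in an initial segment, where the independence of the Brownian increments applies.\<close>

lemma indep_vars_incr:
  assumes h: "0 < h"
  shows "indep_vars (\<lambda>_. borel) (\<lambda>i \<omega>. incr h \<omega> i) UNIV"
  unfolding indep_vars_def2
proof (intro conjI ballI)
  fix i show "random_variable borel (\<lambda>\<omega>. incr h \<omega> i)" using h by (rule measurable_incr)
next
  let ?F = "\<lambda>i. {(\<lambda>\<omega>. incr h \<omega> i) -` A \<inter> space M | A. A \<in> sets borel}"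
  show "indep_sets ?F UNIV"
  proof (subst indep_sets_finite_index_sets, intro allI impI)
    fix J :: "nat set" assume J: "finite J"
    have "indep_vars (\<lambda>_. borel) (\<lambda>i \<omega>. B (h * real (Suc i)) \<omega> - B (h * real i) \<omega>) {..<Suc (Max J)}"
      using h by (intro B_independent_increments) (auto intro!: mult_strict_left_mono)
    then have F: "indep_sets ?F {..<Suc (Max J)}"
      unfolding indep_vars_def2 incr_def by simp
    show "indep_sets ?F J"
      by (rule indep_sets_mono_index[OF _ F]) (use J in \<open>auto simp: less_Suc_eq_le\<close>)
  qed
qed

lemma distr_incr:
  assumes h: "0 < h"
  shows "distr M (\<Pi>\<^sub>M i\<in>UNIV. borel) (incr h)
    = (\<Pi>\<^sub>M i\<in>(UNIV :: nat set). density lborel (normal_density 0 (sqrt h)))"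
proof -
  have "distr M borel (\<lambda>\<omega>. incr h \<omega> i) = density lborel (normal_density 0 (sqrt h))" for i
  proof -
    have "distributed M lborel (\<lambda>\<omega>. incr h \<omega> i)
        (normal_density 0 (sqrt (h * real (Suc i) - h * real i)))"
      unfolding incr_def using h by (intro B_gaussian_increments) auto
    then show ?thesis
      by (simp add: distributed_def algebra_simps cong: distr_cong)
  qed
  moreover have "distr M (\<Pi>\<^sub>M i\<in>UNIV. borel) (\<lambda>\<omega>. \<lambda>i\<in>UNIV. incr h \<omega> i)
      = (\<Pi>\<^sub>M i\<in>UNIV. distr M borel (\<lambda>\<omega>. incr h \<omega> i))"
    using indep_vars_incr[OF h] measurable_incr[OF h]
    by (subst (asm) indep_vars_iff_distr_eq_PiM) auto
  ultimately show ?thesis by (simp add: restrict_UNIV)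
qed

lemma psum_incr: "psum (incr h \<omega>) k = B (h * real k) \<omega> - B 0 \<omega>"
  by (induction k) (simp_all add: psum_Suc incr_def)

lemma npos_incr:
  assumes "B 0 \<omega> = 0"
  shows "real (npos (incr h \<omega>) n) = (\<Sum>k<n. of_bool (0 < B (h * real (Suc k)) \<omega>))"
  unfolding npos_def of_nat_sum psum_incr using assms by (intro sum.cong) (auto simp del: of_nat_Suc)

lemma measurable_npos_incr:
  assumes h: "0 < h"
  shows "(\<lambda>\<omega>. npos (incr h \<omega>) n) \<in> M \<rightarrow>\<^sub>M count_space UNIV"
  unfolding npos_def psum_def using measurable_incr[OF h] by measurable

text \<open>The mesh drops out of the result because the law of \<open>npos\<close> is the same for
  every symmetric, atomless step law.\<close>

lemma expectation_npos_incr: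
  assumes h: "0 < h" and "j \<le> n"
  shows "expectation (\<lambda>\<omega>. real (npos (incr h \<omega>) n choose j)) = arc_coeff j * real (n choose j)"
proof -
  let ?N = "density lborel (normal_density 0 (sqrt h))"
  interpret W: symmetric_walk ?N
    using h by (intro symmetric_walk_normal) simp
  have [measurable]: "incr h \<in> M \<rightarrow>\<^sub>M (\<Pi>\<^sub>M i\<in>UNIV. borel)"
    using measurable_incr[OF h] by (intro measurable_PiM_single') auto
  have sets: "sets (\<Pi>\<^sub>M i\<in>(UNIV :: nat set). ?N) = sets (\<Pi>\<^sub>M i\<in>UNIV. borel)"
    by (intro sets_PiM_cong) auto
  have "(\<lambda>x. npos x n) \<in> (\<Pi>\<^sub>M i\<in>UNIV. borel) \<rightarrow>\<^sub>M count_space UNIV"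
    using W.measurable_npos[of n] by (simp cong: measurable_cong_sets add: sets)
  then have [measurable]: "(\<lambda>x. real (npos x n choose j)) \<in> borel_measurable (\<Pi>\<^sub>M i\<in>UNIV. borel)"
    by measurable
  have "expectation (\<lambda>\<omega>. real (npos (incr h \<omega>) n choose j))
      = (\<integral>x. real (npos x n choose j) \<partial>distr M (\<Pi>\<^sub>M i\<in>UNIV. borel) (incr h))"
    by (rule integral_distr[symmetric]) measurable
  then show ?thesis
    using W.expectation_npos_binomial[OF \<open>j \<le> n\<close>] by (simp add: distr_incr[OF h])
qed

lemma AE_B_nonzero:
  assumes "0 < s"
  shows "AE \<omega> in M. B s \<omega> \<noteq> 0"
proof -
  have D: "distributed M lborel (\<lambda>\<omega>. B s \<omega> - B 0 \<omega>) (normal_density 0 (sqrt (s - 0)))"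
    using assms by (intro B_gaussian_increments) auto
  have "AE x in density lborel (normal_density 0 (sqrt (s - 0))). x \<noteq> 0"
    by (subst AE_density) (auto intro!: AE_lborel_singleton eventually_mono[OF AE_lborel_singleton])
  then have "AE x in distr M lborel (\<lambda>\<omega>. B s \<omega> - B 0 \<omega>). x \<noteq> 0"
    unfolding distributed_distr_eq_density[OF D] .
  then have "AE \<omega> in M. B s \<omega> - B 0 \<omega> \<noteq> 0"
    using distributed_measurable[OF D] by (subst (asm) AE_distr_iff) auto
  with B_start show ?thesis by eventually_elim simp
qed

text \<open>At each fixed positive time \<open>B\<close> is almost surely nonzero. Fubini, in the
  form \<open>AE_commute\<close>, exchanges the two almost-everywhere quantifiers; time 0 is a
  single point and hence negligible.\<close>

lemma AE_null_zero_set: "AE \<omega> in M. AE s in lborel. 0 \<le> s \<longrightarrow> B s \<omega> \<noteq> 0"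
proof -
  interpret pair_sigma_finite M lborel ..
  have [measurable]: "(\<lambda>p. B (max 0 (snd p)) (fst p)) \<in> borel_measurable (M \<Otimes>\<^sub>M lborel)"
    using measurable_continuous_paths[of B M, OF random_variable_B B_continuous]
    by (simp cong: measurable_cong_sets sets_pair_measure_cong)
  have "AE s in lborel. s \<noteq> 0" by (rule AE_lborel_singleton)
  then have "AE s in lborel. AE \<omega> in M. 0 \<le> s \<longrightarrow> B (max 0 s) \<omega> \<noteq> 0"
  proof eventually_elim
    case (elim s)
    show ?case
    proof (cases "0 < s")
      case True
      then show ?thesis using AE_B_nonzero[OF True] by (auto elim: eventually_mono)
    qed (use elim in auto)
  qed
  then have "AE \<omega> in M. AE s in lborel. 0 \<le> s \<longrightarrow> B (max 0 s) \<omega> \<noteq> 0"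
  proof (subst AE_commute)
    show "{p \<in> space (M \<Otimes>\<^sub>M lborel). 0 \<le> snd p \<longrightarrow> B (max 0 (snd p)) (fst p) \<noteq> 0} \<in> sets (M \<Otimes>\<^sub>M lborel)"
      by measurable
  qed
  then show ?thesis
    by (elim eventually_mono) (auto elim: eventually_mono)
qed

lemma AE_npos_tendsto_sojourn:
  assumes t: "0 < t"
  shows "AE \<omega> in M. (\<lambda>n. t / real n * real (npos (incr (t / real n) \<omega>) n)) \<longlonglongrightarrow> sojourn_pos B t \<omega>"
  using B_start AE_null_zero_set AE_space
proof eventually_elim
  case (elim \<omega>)
  then show ?case
    using riemann_sum_positive_times[OF t B_continuous[OF elim(3)] elim(2)]
    by (simp add: npos_incr sojourn_pos_def del: of_nat_Suc)
qed

lemma measurable_sojourn [measurable]: "random_variable borel (sojourn_pos B t)"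
  using random_variable_B B_continuous by (rule measurable_sojourn_pos)

text \<open>\<open>F n m\<close> is a falling factorial of \<open>m\<close> with every factor scaled
  by the mesh. In the limit the shifts by \<open>i\<close> vanish, so it becomes a power, while its
  expectation is an exactly known binomial moment. Dominated convergence joins the two
  facts.\<close>

lemma sojourn_moment:
  assumes t: "0 < t"
  shows "expectation (\<lambda>\<omega>. sojourn_pos B t \<omega> ^ j) = t ^ j * arc_coeff j"
proof -
  define N where "N n \<omega> = npos (incr (t / real (Suc n)) \<omega>) (Suc n)" for n \<omega>
  define F where "F n m = (\<Prod>i<j. t / real (Suc n) * (real m - real i))" for n m
  have [measurable]: "N n \<in> M \<rightarrow>\<^sub>M count_space UNIV" for n
    unfolding N_def using t by (intro measurable_npos_incr) auto
  have F_binomial: "F n m = (t / real (Suc n)) ^ j * fact j * real (m choose j)" for n m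
    unfolding F_def prod.distrib using real_binomial_prod[of m j] by (simp add: mult.commute mult.left_commute)
  have lim0: "(\<lambda>n. t / real (Suc n) * real i) \<longlonglongrightarrow> 0" for i
    using tendsto_mult_right[OF LIMSEQ_Suc[OF lim_const_over_n[of t]], of "real i"]
    by (simp add: tendsto_mult_left_zero LIMSEQ_Suc lim_const_over_n)
  have F_lim: "(\<lambda>n. F n (m n)) \<longlonglongrightarrow> x ^ j"
    if "(\<lambda>n. t / real (Suc n) * real (m n)) \<longlonglongrightarrow> x" for m x
  proof -
    have "(\<lambda>n. \<Prod>i<j. t / real (Suc n) * real (m n) - t / real (Suc n) * real i) \<longlonglongrightarrow> (\<Prod>i<j. x - 0)"
      by (intro tendsto_prod tendsto_diff that lim0)
    then show ?thesis by (simp add: F_def right_diff_distrib del: of_nat_Suc)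
  qed
  have "(\<lambda>n. expectation (\<lambda>\<omega>. F n (N n \<omega>))) \<longlonglongrightarrow> expectation (\<lambda>\<omega>. sojourn_pos B t \<omega> ^ j)"
  proof (rule integral_dominated_convergence[where w="\<lambda>_. (\<Prod>i<j. t + t * real i)"])
    show "AE \<omega> in M. (\<lambda>n. F n (N n \<omega>)) \<longlonglongrightarrow> sojourn_pos B t \<omega> ^ j"
      using AE_npos_tendsto_sojourn[OF t]
    proof eventually_elim
      case (elim \<omega>)
      show ?case using LIMSEQ_Suc[OF elim] unfolding N_def[symmetric] by (rule F_lim)
    qed
    show "AE \<omega> in M. norm (F n (N n \<omega>)) \<le> (\<Prod>i<j. t + t * real i)" for n
    proof (intro AE_I2)
      fix \<omega>
      have "\<bar>t / real (Suc n) * (real (N n \<omega>) - real i)\<bar> \<le> t + t * real i" for i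
      proof -
        have "\<bar>t / real (Suc n) * (real (N n \<omega>) - real i)\<bar>
            \<le> t / real (Suc n) * (real (Suc n) + real (Suc n) * real i)"
        proof -
          have "real (N n \<omega>) \<le> real (Suc n)"
            unfolding N_def of_nat_le_iff by (rule npos_le)
          moreover have "real i \<le> real (Suc n) * real i"
            using mult_right_mono[of 1 "real (Suc n)" "real i"] by simp
          ultimately have "\<bar>real (N n \<omega>) - real i\<bar> \<le> real (Suc n) + real (Suc n) * real i"
            using of_nat_0_le_iff[of "N n \<omega>"] of_nat_0_le_iff[of i] of_nat_0_le_iff[of "Suc n"]
            unfolding abs_le_iff by linarith
          then show ?thesis unfolding abs_mult using t by (intro mult_mono) auto
        qed
        also have "\<dots> = t + t * real i"
          by (simp add: distrib_left del: of_nat_Suc)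
        finally show ?thesis .
      qed
      then show "norm (F n (N n \<omega>)) \<le> (\<Prod>i<j. t + t * real i)"
        unfolding F_def real_norm_def abs_prod by (intro prod_mono) auto
    qed
  qed (auto simp: F_def)
  \<comment> \<open>Once \<open>n\<close> is at least \<open>j\<close>, the expectation equals
    \<open>arc_coeff j * F n (Suc n)\<close>. With \<open>m n = Suc n\<close> the scaled count is
    constantly \<open>t\<close>, so \<open>F_lim\<close> gives this limit as well.\<close>
  moreover have "(\<lambda>n. expectation (\<lambda>\<omega>. F n (N n \<omega>))) \<longlonglongrightarrow> arc_coeff j * t ^ j"
  proof (rule Lim_transform_eventually)
    have "(\<lambda>n. t / real (Suc n) * real (Suc n)) \<longlonglongrightarrow> t" by (simp del: of_nat_Suc)
    then show "(\<lambda>n. arc_coeff j * F n (Suc n)) \<longlonglongrightarrow> arc_coeff j * t ^ j"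
      by (intro tendsto_mult_left F_lim)
    show "\<forall>\<^sub>F n in sequentially. arc_coeff j * F n (Suc n) = expectation (\<lambda>\<omega>. F n (N n \<omega>))"
      using eventually_ge_at_top[of j]
    proof eventually_elim
      case (elim n)
      have "expectation (\<lambda>\<omega>. real (N n \<omega> choose j)) = arc_coeff j * real (Suc n choose j)"
        unfolding N_def using t elim by (intro expectation_npos_incr) auto
      then show ?case by (simp add: F_binomial del: of_nat_Suc binomial_Suc_Suc)
    qed
  qed
  ultimately have "expectation (\<lambda>\<omega>. sojourn_pos B t \<omega> ^ j) = arc_coeff j * t ^ j"
    by (rule LIMSEQ_unique)
  then show ?thesis by (simp add: mult.commute)
qed

theorem arcsine_law:
  assumes "0 < t"
  shows "distributed M lborel (sojourn_pos B t) (sojourn_density t)"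
  using assms sojourn_moment[OF assms] sojourn_pos_bounds[of t B]
  by (intro distributed_arcsine[where C=t]) auto

end

subsection \<open>Kummer's function and the Bessel function\<close>

definition kummer_coeff :: "nat \<Rightarrow> real" where
  "kummer_coeff k = (- 1) ^ k * arc_coeff k / fact k"

definition kummer :: "real \<Rightarrow> real" where
  "kummer x = (\<Sum>k. kummer_coeff k * x ^ k)"

lemma arc_coeff_Suc: "real (Suc k) * arc_coeff (Suc k) = (real k + 1/2) * arc_coeff k"
  by (simp add: arc_coeff_def pochhammer_Suc fact_Suc add.commute mult.commute del: of_nat_Suc)

text \<open>This hypergeometric recurrence is the content of both the analytic equation
  \<open>kummer_ode\<close> and the formal one \<open>kummer_fps_ode\<close>.\<close>

lemma kummer_coeff_Suc:
  "(real (Suc k))\<^sup>2 * kummer_coeff (Suc k) = - (real k + 1/2) * kummer_coeff k"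
proof -
  have "(real (Suc k))\<^sup>2 * kummer_coeff (Suc k)
      = - ((- 1) ^ k * (real (Suc k) * arc_coeff (Suc k)) / fact k)"
    by (simp add: kummer_coeff_def power2_eq_square del: of_nat_Suc)
  also have "\<dots> = - (real k + 1/2) * kummer_coeff k"
    unfolding arc_coeff_Suc by (simp add: kummer_coeff_def field_simps)
  finally show ?thesis .
qed

lemma arc_coeff_le_1: "arc_coeff k \<le> 1"
proof (induction k)
  case (Suc k)
  have "real (Suc k) * arc_coeff (Suc k) \<le> real (Suc k) * 1"
    unfolding arc_coeff_Suc using Suc arc_coeff_nonneg[of k]
    by (intro mult_mono) auto
  then show ?case by (subst (asm) mult_le_cancel_left_pos) auto
qed (simp add: arc_coeff_def)

lemma summable_norm_kummer: "summable (\<lambda>k. norm (kummer_coeff k * x ^ k))"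
proof (rule summable_comparison_test'[OF summable_norm_exp[of x]])
  fix k
  have "arc_coeff k / fact k * \<bar>x\<bar> ^ k \<le> 1 / fact k * \<bar>x\<bar> ^ k"
    by (intro mult_right_mono divide_right_mono arc_coeff_le_1) auto
  then show "norm (norm (kummer_coeff k * x ^ k)) \<le> norm (x ^ k /\<^sub>R fact k)"
    using arc_coeff_nonneg[of k]
    by (simp add: kummer_coeff_def abs_mult power_abs divide_inverse mult.commute)
qed

lemma summable_kummer: "summable (\<lambda>k. kummer_coeff k * x ^ k)"
  using summable_norm_kummer by (rule summable_norm_cancel)

text \<open>Multiplying the derivative by \<open>x\<close> restores the original exponents, so that
  all terms of a differential equation can be compared at the same power
  \<open>x ^ k\<close>.\<close>

lemma times_power_sums:
  fixes c :: "nat \<Rightarrow> real"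
  assumes "\<And>x. summable (\<lambda>k. c k * x ^ k)"
  shows "(\<lambda>k. real k * c k * x ^ k) sums (x * (\<Sum>k. diffs c k * x ^ k))"
proof -
  have "(\<lambda>k. x * (diffs c k * x ^ k)) sums (x * (\<Sum>k. diffs c k * x ^ k))"
    using termdiff_converges_all[OF assms] by (intro sums_mult summable_sums)
  then have "(\<lambda>k. real (Suc k) * c (Suc k) * x ^ Suc k) sums (x * (\<Sum>k. diffs c k * x ^ k))"
    by (simp add: diffs_def mult_ac)
  then show ?thesis by (subst (asm) sums_Suc_iff) simp
qed

definition kummer' :: "real \<Rightarrow> real" where
  "kummer' x = (\<Sum>k. diffs kummer_coeff k * x ^ k)"

definition kummer'' :: "real \<Rightarrow> real" where
  "kummer'' x = (\<Sum>k. diffs (diffs kummer_coeff) k * x ^ k)"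

lemma DERIV_kummer: "(kummer has_field_derivative kummer' x) (at x)"
  unfolding kummer_def kummer'_def
  by (rule termdiffs_strong_converges_everywhere) (rule summable_kummer)

lemma DERIV_kummer': "(kummer' has_field_derivative kummer'' x) (at x)"
  unfolding kummer'_def kummer''_def
  by (rule termdiffs_strong_converges_everywhere) (rule termdiff_converges_all[OF summable_kummer])

text \<open>At \<open>x ^ k\<close> the first two derivative terms contribute
  \<open>(k + 1)\<^sup>2 * kummer_coeff (k + 1)\<close> and the rest
  \<open>(k + 1/2) * kummer_coeff k\<close>; these cancel by
  \<open>kummer_coeff_Suc\<close>.\<close>

lemma kummer_ode: "x * kummer'' x + (1 + x) * kummer' x + kummer x / 2 = 0"
proof -
  let ?d = "diffs kummer_coeff"
  have s: "\<And>x. summable (\<lambda>k. ?d k * x ^ k)"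
    by (rule termdiff_converges_all[OF summable_kummer])
  have "(\<lambda>k. real k * ?d k * x ^ k + ?d k * x ^ k + real k * kummer_coeff k * x ^ k + kummer_coeff k * x ^ k / 2)
      sums (x * kummer'' x + kummer' x + x * kummer' x + kummer x / 2)"
    unfolding kummer_def kummer'_def kummer''_def
    by (intro sums_add times_power_sums sums_divide summable_sums summable_kummer s)
  moreover have "real k * ?d k * x ^ k + ?d k * x ^ k + real k * kummer_coeff k * x ^ k + kummer_coeff k * x ^ k / 2 = 0" for k
  proof -
    have "real k * ?d k + ?d k = (real (Suc k))\<^sup>2 * kummer_coeff (Suc k)"
      by (simp add: diffs_def power2_eq_square algebra_simps)
    then have "real k * ?d k + ?d k + real k * kummer_coeff k + kummer_coeff k / 2 = 0"
      unfolding kummer_coeff_Suc by (simp add: algebra_simps)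
    then have "(real k * ?d k + ?d k + real k * kummer_coeff k + kummer_coeff k / 2) * x ^ k = 0"
      by simp
    then show ?thesis by (simp add: algebra_simps)
  qed
  ultimately have "x * kummer'' x + kummer' x + x * kummer' x + kummer x / 2 = 0"
    using sums_unique2[OF _ sums_zero] by simp
  then show ?thesis by (simp add: algebra_simps)
qed

text \<open>The formal version allows multiplication by \<open>fps_exp\<close> and comparison of
  coefficients without questions of convergence.\<close>

lemma kummer_fps_ode:
  defines "C \<equiv> Abs_fps kummer_coeff"
  shows "fps_X * fps_deriv (fps_deriv C) + (1 + fps_X) * fps_deriv C + fps_const (1/2) * C = 0"
proof (rule fps_ext)
  fix n
  have "fps_nth (fps_X * fps_deriv (fps_deriv C) + (1 + fps_X) * fps_deriv C + fps_const (1/2) * C) n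
      = (real (Suc n))\<^sup>2 * kummer_coeff (Suc n) + (real n + 1/2) * kummer_coeff n"
    by (cases n) (simp_all add: C_def distrib_right power2_eq_square algebra_simps)
  also have "\<dots> = fps_nth 0 n"
    unfolding kummer_coeff_Suc by (simp add: algebra_simps)
  finally show "fps_nth (fps_X * fps_deriv (fps_deriv C) + (1 + fps_X) * fps_deriv C + fps_const (1/2) * C) n
      = fps_nth 0 n" .
qed

text \<open>Multiplying by \<open>exp (x / 2)\<close> turns Kummer's equation into \<open>x G'' + G' = x G / 4\<close>, which
  links only coefficients at distance two.\<close>

lemma exp_kummer_fps_recurrence:
  defines "G \<equiv> fps_exp (1/2) * Abs_fps kummer_coeff"
  shows "fps_nth G 0 = 1" "fps_nth G 1 = 0" "4 * (real n + 2)\<^sup>2 * fps_nth G (n + 2) = fps_nth G n"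
proof -
  define C where "C = Abs_fps kummer_coeff"
  define E where "E = fps_exp (1/2 :: real)"
  define h where "h = fps_const (1/2 :: real)"
  have hh: "h + h = 1" by (simp add: h_def)
  have hh4: "h * h = fps_const (1/4)" by (simp add: h_def)
  have E': "fps_deriv E = h * E" by (simp add: E_def h_def)
  have h': "fps_deriv h = 0" by (simp add: h_def)
  have G: "G = E * C" by (simp add: G_def E_def C_def)
  have G1: "fps_deriv G = h * E * C + E * fps_deriv C"
    by (simp add: G E' algebra_simps)
  have G2: "fps_deriv (fps_deriv G) = h * h * E * C + (h + h) * E * fps_deriv C + E * fps_deriv (fps_deriv C)"
    by (simp add: G1 E' h' algebra_simps)
  have "E * (fps_X * fps_deriv (fps_deriv C) + (1 + fps_X) * fps_deriv C + h * C) = 0"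
    unfolding C_def h_def kummer_fps_ode by simp
  then have ode: "fps_X * fps_deriv (fps_deriv G) + fps_deriv G = fps_const (1/4) * (fps_X * G)"
    unfolding G2 unfolding G1 hh by (simp add: G hh4[symmetric] algebra_simps)
  show "fps_nth G 0 = 1" by (simp add: G_def kummer_coeff_def arc_coeff_def)
  \<comment> \<open>The equation is read at order 0, where its right side vanishes, and then at
    order \<open>n + 1\<close>, where the two left terms combine to \<open>(n + 2)\<^sup>2\<close>
    times the coefficient of order \<open>n + 2\<close>.\<close>
  show "fps_nth G 1 = 0" using arg_cong[OF ode, of "\<lambda>f. fps_nth f 0"] by simp
  have "real (n + 1) * (real (n + 2) * fps_nth G (n + 2)) + real (n + 2) * fps_nth G (n + 2)
      = fps_nth G n / 4"
    using arg_cong[OF ode, of "\<lambda>f. fps_nth f (n + 1)"] by simp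
  then show "4 * (real n + 2)\<^sup>2 * fps_nth G (n + 2) = fps_nth G n"
    by (simp add: power2_eq_square algebra_simps)
qed

text \<open>From order \<open>2 * k\<close> to \<open>2 * k + 2\<close> the recurrence divides by
  \<open>4 * (2 * k + 2)\<^sup>2 = 16 * (k + 1)\<^sup>2\<close>; the odd coefficients inherit the
  zero at order 1.\<close>

lemma exp_kummer_fps_nth:
  defines "G \<equiv> fps_exp (1/2) * Abs_fps kummer_coeff"
  shows "fps_nth G (2 * k) = 1 / (16 ^ k * (fact k)\<^sup>2)" "fps_nth G (2 * k + 1) = 0"
proof (induction k)
  case 0
  { case 1 show ?case using exp_kummer_fps_recurrence(1) by (simp add: G_def) next
    case 2 show ?case using exp_kummer_fps_recurrence(2) by (simp add: G_def) }
next
  case (Suc k)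
  { case 1 
    have X: "16 * (real k + 1)\<^sup>2 * fps_nth G (2 * k + 2) = 1 / (16 ^ k * (fact k)\<^sup>2)"
      using exp_kummer_fps_recurrence(3)[of "2 * k"] Suc(1)
      by (simp add: G_def power2_eq_square algebra_simps)
    have "real k + 1 \<noteq> 0" by linarith
    then have "16 * (real k + 1)\<^sup>2 \<noteq> 0" by simp
    then have "fps_nth G (2 * k + 2) = 1 / (16 ^ k * (fact k)\<^sup>2) / (16 * (real k + 1)\<^sup>2)"
      unfolding X[symmetric] by (rule nonzero_mult_div_cancel_left[symmetric])
    moreover have "16 ^ Suc k * (fact (Suc k))\<^sup>2 = 16 ^ k * (fact k)\<^sup>2 * (16 * (real k + 1)\<^sup>2)"
      by (simp add: power_mult_distrib add.commute)
    ultimately show ?case by simp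
  next
    case 2
    show ?case
      using exp_kummer_fps_recurrence(3)[of "2 * k + 1"] Suc(2)
      by (simp add: G_def) }
qed

text \<open>The Cauchy product of the series of \<open>exp (x / 2)\<close> and
  \<open>kummer x\<close> has the coefficients of \<open>G\<close>. Only even orders survive, and
  \<open>x ^ (2 * k) / 16 ^ k = (x / 4) ^ (2 * k)\<close> explains the argument \<open>x / 2\<close>
  of \<open>bessel_I0\<close>.\<close>

lemma kummer_eq_bessel: "kummer x = exp (- x / 2) * bessel_I0 (x / 2)"
proof -
  define G where "G = fps_exp (1/2) * Abs_fps kummer_coeff"
  have "(\<lambda>k. \<Sum>i\<le>k. ((x / 2) ^ i /\<^sub>R fact i) * (kummer_coeff (k - i) * x ^ (k - i)))
      sums ((\<Sum>k. (x / 2) ^ k /\<^sub>R fact k) * (\<Sum>k. kummer_coeff k * x ^ k))"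
    by (rule Cauchy_product_sums[OF summable_norm_exp summable_norm_kummer])
  moreover have "(\<Sum>i\<le>k. ((x / 2) ^ i /\<^sub>R fact i) * (kummer_coeff (k - i) * x ^ (k - i))) = fps_nth G k * x ^ k" for k
  proof -
    have "((x / 2) ^ i /\<^sub>R fact i) * (kummer_coeff (k - i) * x ^ (k - i))
        = ((1/2) ^ i / fact i * kummer_coeff (k - i)) * x ^ k" if "i \<le> k" for i
    proof -
      have x: "x ^ k = x ^ i * x ^ (k - i)" using that by (simp flip: power_add)
      have half: "(x / 2) ^ i /\<^sub>R fact i = (1/2) ^ i / fact i * x ^ i"
        by (simp add: power_divide inverse_eq_divide)
      show ?thesis unfolding x half by (simp only: mult_ac)
    qed
    then have "(\<Sum>i\<le>k. ((x / 2) ^ i /\<^sub>R fact i) * (kummer_coeff (k - i) * x ^ (k - i)))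
        = (\<Sum>i\<le>k. ((1/2) ^ i / fact i * kummer_coeff (k - i)) * x ^ k)"
      by (intro sum.cong) auto
    also have "\<dots> = fps_nth G k * x ^ k"
      unfolding G_def fps_mult_nth sum_distrib_right atLeast0AtMost by simp
    finally show ?thesis .
  qed
  ultimately have "(\<lambda>k. fps_nth G k * x ^ k) sums (exp (x / 2) * kummer x)"
    by (simp add: exp_def kummer_def)
  then have "(\<lambda>k. fps_nth G (2 * k) * x ^ (2 * k)) sums (exp (x / 2) * kummer x)"
  proof (subst sums_mono_reindex)
    fix n assume "n \<notin> range (\<lambda>k::nat. 2 * k)"
    then have "odd n" by (auto elim: evenE)
    then obtain k where "n = 2 * k + 1" by (elim oddE)
    then show "fps_nth G n * x ^ n = 0" using exp_kummer_fps_nth(2)[of k] by (simp add: G_def)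
  qed (auto simp: strict_mono_def)
  moreover have "fps_nth G (2 * k) * x ^ (2 * k) = (x / 2 / 2) ^ (2 * k) / (fact k)\<^sup>2" for k
    using exp_kummer_fps_nth(1)[of k] by (simp add: G_def power_divide power_mult)
  ultimately have "bessel_I0 (x / 2) = exp (x / 2) * kummer x"
    unfolding bessel_I0_def by (simp add: sums_iff)
  then show ?thesis by (simp add: exp_minus)
qed

subsection \<open>The crossing probability\<close>

lemma kummer_0: "kummer 0 = 1"
  using powser_zero[of kummer_coeff] by (simp add: kummer_def kummer_coeff_def arc_coeff_def)

context brownian_motion
begin

text \<open>Inserting the moments of the sojourn time into \<open>exp_moment_sums\<close> at
  \<open>z = - lam\<close> yields Kummer's series at \<open>lam * t\<close>. Time 0, where the
  sojourn set is empty, is included for the initial value.\<close>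

lemma expectation_exp_sojourn:
  assumes "0 \<le> t"
  shows "expectation (\<lambda>\<omega>. exp (- lam * sojourn_pos B t \<omega>)) = kummer (lam * t)"
proof (cases "t = 0")
  case True
  have "sojourn_pos B 0 \<omega> = 0" for \<omega>
  proof -
    have "{s. 0 \<le> s \<and> s < 0 \<and> 0 < B s \<omega>} = {}" by auto
    then show ?thesis by (simp only: sojourn_pos_def measure_empty)
  qed
  then show ?thesis using True by (simp add: prob_space kummer_0)
next
  case False
  with assms have t: "0 < t" by simp
  have bound: "AE \<omega> in M. \<bar>sojourn_pos B t \<omega>\<bar> \<le> t"
    using t by (intro AE_I2 sojourn_pos_bounds) simp
  have "(\<lambda>k. of_real (kummer_coeff k * (lam * t) ^ k) :: complex)
      sums (\<integral>\<omega>. exp (- of_real lam * of_real (sojourn_pos B t \<omega>)) \<partial>M)"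
    using exp_moment_sums[OF measurable_sojourn bound, of "- of_real lam"]
    by (simp add: sojourn_moment[OF t] kummer_coeff_def power_mult_distrib power_minus[of "of_real lam :: complex"] mult_ac)
  also have "(\<integral>\<omega>. exp (- of_real lam * of_real (sojourn_pos B t \<omega>)) \<partial>M)
      = (\<integral>\<omega>. (of_real (exp (- lam * sojourn_pos B t \<omega>)) :: complex) \<partial>M)"
    by (simp flip: exp_of_real)
  also have "\<dots> = of_real (expectation (\<lambda>\<omega>. exp (- lam * sojourn_pos B t \<omega>)))"
    by (rule integral_complex_of_real)
  finally show ?thesis by (simp only: sums_of_real_iff kummer_def sums_unique)
qed

text \<open>Conditioning on the path, \<open>U\<close> exceeds the level \<open>sojourn_pos B t\<close> with probability
  \<open>exp (- lam * sojourn_pos B t)\<close>.\<close>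

lemma crossing_prob_eq:
  assumes lam: "0 < lam" and t: "0 \<le> t"
    and U: "distributed M lborel U (exponential_density lam)"
    and indep: "indep_set (sets (vimage_algebra (space M) U borel))
      (sets (vimage_algebra (space M) (\<lambda>\<omega>. \<lambda>s\<in>{0..}. B s \<omega>) (PiM {0..} (\<lambda>_. borel))))"
  shows "crossing_prob M B U t = kummer (lam * t)"
proof -
  let ?V = "vimage_algebra (space M) (\<lambda>\<omega>. \<lambda>s\<in>{0..}. B s \<omega>) (PiM {0..} (\<lambda>_. borel))"
  let ?G = "sojourn_pos B t"
  have rv_U [measurable]: "random_variable borel U"
    using distributed_measurable[OF U] by simp
  have "(\<lambda>\<omega>. \<lambda>s\<in>{0..}. B s \<omega>) \<in> ?V \<rightarrow>\<^sub>M PiM {0..} (\<lambda>_. borel)"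
    by (intro measurable_vimage_algebra1) (auto simp: space_PiM)
  from measurable_compose[OF this measurable_component_singleton]
  have "B s \<in> borel_measurable ?V" if "0 \<le> s" for s
    using that by simp
  \<comment> \<open>The sojourn time is a functional of the path, so its sigma-algebra lies inside
    \<open>?V\<close> and inherits independence from \<open>U\<close>.\<close>
  then have "?G \<in> borel_measurable ?V"
    by (rule measurable_sojourn_pos) (auto intro: B_continuous)
  then have sub: "sets (vimage_algebra (space M) ?G borel) \<subseteq> sets ?V"
    by (intro sets_image_in_sets) auto
  have "indep_set (sets (vimage_algebra (space M) ?G borel)) (sets (vimage_algebra (space M) U borel))"
    unfolding indep_sets2_eq
  proof (intro conjI ballI)
    fix a b
    assume a: "a \<in> sets (vimage_algebra (space M) ?G borel)" and b: "b \<in> sets (vimage_algebra (space M) U borel)"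
    have "prob (b \<inter> a) = prob b * prob a"
      using indep a b sub unfolding indep_sets2_eq by blast
    then show "prob (a \<inter> b) = prob a * prob b"
      by (simp add: Int_commute mult.commute)
  qed (use indep sub in \<open>auto simp: indep_sets2_eq\<close>)
  then have "indep_var borel ?G borel U"
    unfolding indep_var_eq sets_vimage_algebra by simp
  then have joint: "distr M (borel \<Otimes>\<^sub>M borel) (\<lambda>\<omega>. (?G \<omega>, U \<omega>)) = distr M borel ?G \<Otimes>\<^sub>M distr M borel U"
    unfolding indep_var_distribution_eq by simp
  interpret DU: prob_space "distr M borel U" by (rule prob_space_distr) simp
  let ?Q = "{p :: real \<times> real. fst p < snd p}"
  have "Measurable.pred (borel \<Otimes>\<^sub>M borel) (\<lambda>p :: real \<times> real. fst p < snd p)" by measurable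
  then have Q: "?Q \<in> sets (borel \<Otimes>\<^sub>M borel)" by (simp add: pred_def space_pair_measure)
  have tail: "emeasure (distr M borel U) {u. g < u} = ennreal (exp (- lam * g))" if "0 \<le> g" for g
    using exponential_distributedD_gt[OF U that lam]
    by (subst emeasure_distr) (auto simp: emeasure_eq_measure vimage_def Int_def conj_commute mult.commute)
  have "ennreal (crossing_prob M B U t) = emeasure M {\<omega> \<in> space M. ?G \<omega> < U \<omega>}"
    by (simp add: crossing_prob_def emeasure_eq_measure)
  also have "\<dots> = emeasure (distr M (borel \<Otimes>\<^sub>M borel) (\<lambda>\<omega>. (?G \<omega>, U \<omega>))) ?Q"
    using Q by (subst emeasure_distr) (auto intro!: arg_cong[where f="emeasure M"])
  also have "\<dots> = (\<integral>\<^sup>+g. emeasure (distr M borel U) (Pair g -` ?Q) \<partial>distr M borel ?G)"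
    unfolding joint using Q by (intro DU.emeasure_pair_measure_alt) (simp cong: sets_pair_measure_cong)
  also have "\<dots> = (\<integral>\<^sup>+\<omega>. emeasure (distr M borel U) (Pair (?G \<omega>) -` ?Q) \<partial>M)"
    using DU.measurable_emeasure_Pair[of ?Q borel] Q
    by (intro nn_integral_distr) (simp_all cong: sets_pair_measure_cong)
  also have "\<dots> = (\<integral>\<^sup>+\<omega>. ennreal (exp (- lam * ?G \<omega>)) \<partial>M)"
    by (intro nn_integral_cong) (simp add: vimage_def tail sojourn_pos_def)
  also have "\<dots> = ennreal (expectation (\<lambda>\<omega>. exp (- lam * ?G \<omega>)))"
  proof (intro nn_integral_eq_integral integrable_const_bound[where B=1])
    show "AE \<omega> in M. norm (exp (- lam * ?G \<omega>)) \<le> 1"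
      using lam by (simp add: sojourn_pos_def)
  qed auto
  also have "\<dots> = ennreal (kummer (lam * t))"
    by (simp only: expectation_exp_sojourn[OF t])
  finally have "ennreal (crossing_prob M B U t) = ennreal (kummer (lam * t))" .
  moreover have "0 \<le> kummer (lam * t)"
    unfolding expectation_exp_sojourn[OF t, symmetric] by simp
  moreover have "0 \<le> crossing_prob M B U t"
    by (simp add: crossing_prob_def)
  ultimately show ?thesis by simp
qed

end

theorem theorem2p2:
  fixes M :: "'a measure" and B :: "real \<Rightarrow> 'a \<Rightarrow> real" and U :: "'a \<Rightarrow> real" and lam :: real
  assumes "lam > 0"
    and "brownian_motion M B"
    and "distributed M lborel U (exponential_density lam)"
    and "prob_space.indep_set M
           (sets (vimage_algebra (space M) U borel))
           (sets (vimage_algebra (space M) (\<lambda>\<omega>. \<lambda>s\<in>{0..}. B s \<omega>) (PiM {0..} (\<lambda>_. borel))))"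
  shows "(\<forall>t>0. distributed M lborel (sojourn_pos B t) (sojourn_density t))
    \<and> (\<forall>t>0. crossing_prob M B U t = exp (- lam * t / 2) * bessel_I0 (lam * t / 2))
    \<and> (\<forall>t>0. crossing_prob M B U differentiable at t
           \<and> deriv (crossing_prob M B U) differentiable at t
           \<and> deriv (deriv (crossing_prob M B U)) t
               + (lam + 1 / t) * deriv (crossing_prob M B U) t
             = - (lam / (2 * t)) * crossing_prob M B U t)
    \<and> crossing_prob M B U 0 = 1
    \<and> (crossing_prob M B U \<longlongrightarrow> 1) (at_right 0)"
proof -
  interpret brownian_motion M B by fact
  let ?\<psi> = "crossing_prob M B U"
  have \<psi>: "?\<psi> t = kummer (lam * t)" if "0 \<le> t" for t
    using assms that by (intro crossing_prob_eq) auto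
  \<comment> \<open>The formula for \<open>?\<psi>\<close> covers nonnegative times only;
    derivatives at \<open>t > 0\<close> are transferred on a neighbourhood of positive
    times.\<close>
  have pos_nhds: "eventually (\<lambda>s. 0 < s) (nhds t)" if "0 < t" for t :: real
    using that eventually_nhds_in_open[of "{0<..}" t] by simp
  have D0: "((\<lambda>t. kummer (lam * t)) has_field_derivative lam * kummer' (lam * t)) (at t)" for t
    using DERIV_chain2[OF DERIV_kummer[of "lam * t"] DERIV_cmult_Id[of lam t]] by (simp add: mult.commute)
  have D1: "(?\<psi> has_field_derivative lam * kummer' (lam * t)) (at t)" if t: "0 < t" for t
  proof -
    have "eventually (\<lambda>s. ?\<psi> s = kummer (lam * s)) (nhds t)"
      using pos_nhds[OF t] by eventually_elim (simp add: \<psi>)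
    then show ?thesis using D0[of t] by (subst DERIV_cong_ev) auto
  qed
  have D2: "(deriv ?\<psi> has_field_derivative lam\<^sup>2 * kummer'' (lam * t)) (at t)" if t: "0 < t" for t
  proof -
    have "((\<lambda>t. lam * kummer' (lam * t)) has_field_derivative lam\<^sup>2 * kummer'' (lam * t)) (at t)"
      using DERIV_cmult[OF DERIV_chain2[OF DERIV_kummer'[of "lam * t"] DERIV_cmult_Id[of lam t]], of lam]
      by (simp add: mult_ac power2_eq_square)
    moreover have "eventually (\<lambda>s. deriv ?\<psi> s = lam * kummer' (lam * s)) (nhds t)"
      using pos_nhds[OF t] by eventually_elim (simp add: DERIV_imp_deriv D1)
    ultimately show ?thesis by (subst DERIV_cong_ev) auto
  qed
  have ode: "deriv (deriv ?\<psi>) t + (lam + 1 / t) * deriv ?\<psi> t = - (lam / (2 * t)) * ?\<psi> t" if t: "0 < t" for t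
  proof -
    \<comment> \<open>Multiplied by \<open>t\<close>, the equation is \<open>lam\<close> times
      Kummer's equation at \<open>lam * t\<close>.\<close>
    have "t * (lam\<^sup>2 * kummer'' (lam * t) + (lam + 1 / t) * (lam * kummer' (lam * t)))
        = lam * (lam * t * kummer'' (lam * t) + (1 + lam * t) * kummer' (lam * t))"
      using t by (simp add: field_simps power2_eq_square)
    also have "lam * t * kummer'' (lam * t) + (1 + lam * t) * kummer' (lam * t) = - (kummer (lam * t) / 2)"
      using kummer_ode[of "lam * t"] by (simp add: eq_neg_iff_add_eq_0)
    also have "lam * \<dots> = t * (- (lam / (2 * t)) * kummer (lam * t))"
      using t by simp
    finally have "lam\<^sup>2 * kummer'' (lam * t) + (lam + 1 / t) * (lam * kummer' (lam * t))
        = - (lam / (2 * t)) * kummer (lam * t)"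
      using t by (auto simp only: mult_cancel_left less_irrefl)
    then show ?thesis
      using t by (simp add: DERIV_imp_deriv[OF D1] DERIV_imp_deriv[OF D2] \<psi>)
  qed
  have "isCont (\<lambda>t. kummer (lam * t)) 0"
    using D0 by (rule DERIV_isCont)
  then have "((\<lambda>t. kummer (lam * t)) \<longlongrightarrow> 1) (at_right 0)"
    unfolding isCont_def by (simp add: kummer_0 filterlim_at_split)
  moreover have "eventually (\<lambda>t. kummer (lam * t) = ?\<psi> t) (at_right 0)"
    using eventually_at_right_less[of "0::real"] by eventually_elim (simp add: \<psi>)
  ultimately have "(?\<psi> \<longlongrightarrow> 1) (at_right 0)"
    by (rule Lim_transform_eventually)
  moreover have "?\<psi> t = exp (- lam * t / 2) * bessel_I0 (lam * t / 2)" if "0 < t" for t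
    using that kummer_eq_bessel[of "lam * t"] by (simp add: \<psi>)
  moreover have "?\<psi> differentiable at t" "deriv ?\<psi> differentiable at t" if "0 < t" for t
    using D1[OF that] D2[OF that] by (auto simp: real_differentiable_def)
  moreover have "?\<psi> 0 = 1" by (simp add: \<psi> kummer_0)
  ultimately show ?thesis
    using arcsine_law ode by blast
qed

end
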